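(* Let $u_{\mathcal A}\in\mathcal{PNN}$ be the output of the projected gradient descent algorithm when the deep Ritz method is used to solve the Neumann problem $-\Delta u+\omega u=h$ in $\Omega$, $\partial u/\partial\boldsymbol n=g$ on $\partial\Omega$, with weak solution $u_0$, and let $\bar u\in\operatorname{argmin}_{u\in\mathcal{PNN}'}\|u-u_0\|_{H^1(\Omega)}^2$, where $\mathcal{PNN}$ and $\mathcal{PNN}'\subseteq\mathcal{PNN}$ are parallel neural network classes. Then $$\|u_{\mathcal A}-u_0\|_{H^1(\Omega)}^2\le\frac{2}{c_0\wedge1}\Big\{\frac{B_0\vee1}{2}\|\bar u-u_0\|_{H^1(\Omega)}^2+\big[\widehat{\mathcal L}(u_{\mathcal A})-\widehat{\mathcal L}(\bar u)\big]+2\sup_{u\in\mathcal{PNN}}|\mathcal L(u)-\widehat{\mathcal L}(u)|\Big\}.$$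
   Context: **Problem.** $\Omega\subset[0,1]^d$ is a bounded open set with $\partial\Omega\in C^{2+\alpha}$, $0<\alpha<1$; $h\in L^2(\Omega)$, $g\in H^{1/2}(\partial\Omega)$, $\omega\in C^\alpha(\bar\Omega)$, $\omega\ge c_0>0$. The Neumann problem has a unique weak solution $u_0\in H^2(\Omega)$. $B_0=\max\{\|h\|_{L^\infty(\Omega)},\|g\|_{L^\infty(\partial\Omega)},\|\omega\|_{L^\infty(\Omega)}\}$. $a\wedge b=\min$, $a\vee b=\max$. **Losses.** With $T$ the trace operator, $$\mathcal L(u)=\int_\Omega\Big(\frac12\|\nabla u\|_2^2+\frac12\omega|u|^2-hu\Big)dx-\int_{\partial\Omega}g\,Tu\,ds,$$ $$\widehat{\mathcal L}(u)=\frac{|\Omega|}{N_{\rm in}}\sum_{p=1}^{N_{\rm in}}\Big[\frac{\|\nabla u(X_p)\|_2^2}{2}+\frac{\omega(X_p)u^2(X_p)}{2}-u(X_p)h(X_p)\Big]-\frac{|\partial\Omega|}{N_b}\sum_{p=1}^{N_b}u(Y_p)g(Y_p),$$ with $X_p$ i.i.d. uniform on $\Omega$ and $Y_p$ i.i.d. uniform on $\partial\Omega$. **Parallel networks.** $\rho=\tanh$ componentwise. $\mathcal{NN}(W,L,B_\theta)$: functions $\phi_L$ with $\phi_0(\boldsymbol x)=\boldsymbol x$, $\phi_\ell=\rho(\boldsymbol A_{\ell-1}\phi_{\ell-1}+\boldsymbol b_{\ell-1})$ ($1\le\ell\le L-1$), $\phi_L=\boldsymbol A_{L-1}\phi_{L-1}+\boldsymbol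 b_{L-1}$, scalar output, of width $W$, depth $L$, all weights bounded by $B_\theta$ in absolute value. A parallel neural network class $\mathcal{PNN}(\mathfrak m,M,\{W,L,B_\theta\})$ consists of all $\sum_{k=1}^{\mathfrak m}c_k\phi^k$ with $\phi^k\in\mathcal{NN}(W^k,L^k,B^k)$, $W^k\le W$, $L^k\le L$, $B^k\le B_\theta$, $\sum_k|c_k|\le M$. **PGD output.** $u_{\mathcal A}=\sum_{k=1}^{\mathfrak m}c_k\phi^k_{\boldsymbol\theta}$ with parameters $(\boldsymbol\theta_{\rm in},\boldsymbol\theta_{\rm out})^{[T]}$, where $\boldsymbol\theta_{\rm in}$ collects the sub-network weights and $\boldsymbol\theta_{\rm out}=(c_1,\dots,c_{\mathfrak m})$; $\boldsymbol\theta_{\rm out}^{[0]}=\boldsymbol 0$, entries of $\boldsymbol\theta_{\rm in}^{[0]}$ i.i.d. uniform on $[-B,B]$, and $(\boldsymbol\theta_{\rm in},\boldsymbol\theta_{\rm out})^{[t+1]}$ is the Euclidean projection of $(\boldsymbol\theta_{\rm in},\boldsymbol\theta_{\rm out})^{[t]}-\lambda\nabla\widehat{\mathcal L}$ (gradient in the parameters) onto $\{\|\boldsymbol\theta_{\rm in}-\boldsymbol\theta_{\rm in}^{[0]}\|_2\le\eta\}\times\{\|\boldsymbol\theta_{\rm out}\|_1\le\zeta\}$, $t=0,\dots,T-1$. The class $\mathcal{PNN}$ is one that contains $u_{\mathcal A}$. *)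

theory Defs
  imports "HOL-Probability.Probability"
begin

section \<open>Hoelder spaces and domains of class C^{2+alpha}\<close>

definition holder_on :: "real \<Rightarrow> 'a::metric_space set \<Rightarrow> ('a \<Rightarrow> real) \<Rightarrow> bool" where
  "holder_on \<alpha> S f \<longleftrightarrow> (\<exists>C\<ge>0. \<forall>x\<in>S. \<forall>y\<in>S. \<bar>f x - f y\<bar> \<le> C * dist x y powr \<alpha>)"

text \<open>For open \<open>S\<close>; \<open>G\<close> is the gradient and \<open>H\<close> the Hessian of \<open>f\<close>. On the balls used
  below, Hoelder continuity of \<open>H\<close> already bounds all derivatives of order at most two.\<close>

definition C2_holder_on :: "real \<Rightarrow> (real^'d) set \<Rightarrow> (real^'d \<Rightarrow> real) \<Rightarrow> bool" where
  "C2_holder_on \<alpha> S f \<longleftrightarrow>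
     (\<exists>G :: real^'d \<Rightarrow> real^'d. \<exists>H :: real^'d \<Rightarrow> real^'d^'d.
        (\<forall>x\<in>S. (f has_derivative (\<lambda>v. G x \<bullet> v)) (at x)) \<and>
        (\<forall>x\<in>S. (G has_derivative (\<lambda>v. H x *v v)) (at x)) \<and>
        (\<forall>i j. holder_on \<alpha> S (\<lambda>x. H x $ i $ j)))"

text \<open>Near each boundary point, after relabelling (\<open>i\<close>) and reorienting (\<open>s\<close>) the axes, \<open>\<Omega>\<close>
  is the region above the graph of a \<open>C\<^sup>2\<^sup>+\<^sup>\<alpha>\<close> function of the other \<open>d - 1\<close> coordinates,
  written here as a function on \<open>\<real>\<^sup>d\<close> that does not depend on the \<open>i\<close>-th coordinate.\<close>

definition C2_holder_boundary :: "real \<Rightarrow> (real^'d) set \<Rightarrow> bool" where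
  "C2_holder_boundary \<alpha> \<Omega> \<longleftrightarrow>
     (\<forall>x0\<in>frontier \<Omega>. \<exists>r>0. \<exists>i. \<exists>s\<in>{-1, 1::real}. \<exists>\<gamma>.
        C2_holder_on \<alpha> (ball x0 r) \<gamma> \<and>
        (\<forall>x t. \<gamma> (x + t *\<^sub>R axis i 1) = \<gamma> x) \<and>
        \<Omega> \<inter> ball x0 r = {x \<in> ball x0 r. s * x $ i > \<gamma> x})"


section \<open>Surface measure\<close>

text \<open>The \<open>s\<close>-dimensional Hausdorff measure, normalised so that it agrees with Lebesgue measure
  on \<open>\<real>\<^sup>s\<close>. The case distinction on the empty set matters only for \<open>s = 0\<close>, where \<open>0 ^ 0 = 1\<close>
  yields the counting measure. The covering sets are required to be bounded because \<open>diameter\<close>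
  is meaningful only for bounded sets.\<close>

definition hausdorff_pre :: "nat \<Rightarrow> real \<Rightarrow> 'a::metric_space set \<Rightarrow> ennreal" where
  "hausdorff_pre s \<delta> A =
     (INF U \<in> {U :: nat \<Rightarrow> 'a set. A \<subseteq> (\<Union>n. U n) \<and> (\<forall>n. bounded (U n) \<and> diameter (U n) \<le> \<delta>)}.
        \<Sum>n. if U n = {} then 0
             else ennreal (unit_ball_vol (real s) * (diameter (U n) / 2) ^ s))"

definition hausdorff_outer :: "nat \<Rightarrow> 'a::metric_space set \<Rightarrow> ennreal" where
  "hausdorff_outer s A = (SUP \<delta>\<in>{0<..}. hausdorff_pre s \<delta> A)"

text \<open>By Caratheodory's criterion the outer measure is countably additive on the Borel sets.\<close>

definition hausdorff_measure :: "nat \<Rightarrow> 'a::metric_space measure" where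
  "hausdorff_measure s = measure_of UNIV (sets borel) (hausdorff_outer s)"

definition surface_measure :: "(real^'d) set \<Rightarrow> (real^'d) measure" where
  "surface_measure \<Omega> =
     completion (restrict_space (hausdorff_measure (CARD('d) - 1)) (frontier \<Omega>))"


section \<open>Lebesgue and Sobolev spaces\<close>

text \<open>Elements of these spaces are represented by functions on the whole of \<open>\<real>\<^sup>d\<close>; only their
  values on \<open>\<Omega>\<close> (or \<open>\<partial>\<Omega>\<close>), up to null sets, are relevant.\<close>

definition L2 :: "'a measure \<Rightarrow> ('a \<Rightarrow> real) set" where
  "L2 M = {f. f \<in> borel_measurable M \<and> integrable M (\<lambda>x. (f x)\<^sup>2)}"

definition L2_norm :: "'a measure \<Rightarrow> ('a \<Rightarrow> real) \<Rightarrow> real" where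
  "L2_norm M f = sqrt (LINT x|M. (f x)\<^sup>2)"

definition Linf_norm :: "'a measure \<Rightarrow> ('a \<Rightarrow> real) \<Rightarrow> ereal" where
  "Linf_norm M f = esssup M (\<lambda>x. ereal \<bar>f x\<bar>)"

definition partial :: "'d \<Rightarrow> (real^'d \<Rightarrow> real) \<Rightarrow> real^'d \<Rightarrow> real" where
  "partial i f x = frechet_derivative f (at x) (axis i 1)"

definition grad :: "(real^'d \<Rightarrow> real) \<Rightarrow> real^'d \<Rightarrow> real^'d" where
  "grad f x = (\<chi> i. partial i f x)"

primrec Ck :: "nat \<Rightarrow> (real^'d \<Rightarrow> real) \<Rightarrow> bool" where
  "Ck 0 f \<longleftrightarrow> continuous_on UNIV f"
| "Ck (Suc k) f \<longleftrightarrow> (\<forall>x. f differentiable (at x)) \<and> (\<forall>i. Ck k (partial i f))"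

definition test_functions :: "(real^'d) set \<Rightarrow> (real^'d \<Rightarrow> real) set" where
  "test_functions \<Omega> =
     {\<phi>. (\<forall>k. Ck k \<phi>) \<and> compact (closure {x. \<phi> x \<noteq> 0}) \<and> closure {x. \<phi> x \<noteq> 0} \<subseteq> \<Omega>}"

definition locally_integrable :: "(real^'d) set \<Rightarrow> (real^'d \<Rightarrow> real) \<Rightarrow> bool" where
  "locally_integrable \<Omega> f \<longleftrightarrow> (\<forall>K. compact K \<and> K \<subseteq> \<Omega> \<longrightarrow> integrable (lebesgue_on K) f)"

definition has_weak_grad ::
  "(real^'d) set \<Rightarrow> (real^'d \<Rightarrow> real) \<Rightarrow> (real^'d \<Rightarrow> real^'d) \<Rightarrow> bool" where
  "has_weak_grad \<Omega> u G \<longleftrightarrow>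
     locally_integrable \<Omega> u \<and> (\<forall>i. locally_integrable \<Omega> (\<lambda>x. G x $ i)) \<and>
     (\<forall>\<phi>\<in>test_functions \<Omega>. \<forall>i.
        (LINT x|lebesgue_on \<Omega>. u x * partial i \<phi> x) = - (LINT x|lebesgue_on \<Omega>. G x $ i * \<phi> x))"

definition weak_grad :: "(real^'d) set \<Rightarrow> (real^'d \<Rightarrow> real) \<Rightarrow> real^'d \<Rightarrow> real^'d" where
  "weak_grad \<Omega> u = (SOME G. has_weak_grad \<Omega> u G)"

definition H1 :: "(real^'d) set \<Rightarrow> (real^'d \<Rightarrow> real) set" where
  "H1 \<Omega> = {u \<in> L2 (lebesgue_on \<Omega>).
     \<exists>G. has_weak_grad \<Omega> u G \<and> (\<forall>i. (\<lambda>x. G x $ i) \<in> L2 (lebesgue_on \<Omega>))}"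

definition H1_norm :: "(real^'d) set \<Rightarrow> (real^'d \<Rightarrow> real) \<Rightarrow> real" where
  "H1_norm \<Omega> u = sqrt ((LINT x|lebesgue_on \<Omega>. (u x)\<^sup>2) +
                       (LINT x|lebesgue_on \<Omega>. (norm (weak_grad \<Omega> u x))\<^sup>2))"

definition H2 :: "(real^'d) set \<Rightarrow> (real^'d \<Rightarrow> real) set" where
  "H2 \<Omega> = {u \<in> H1 \<Omega>. \<forall>i. (\<lambda>x. weak_grad \<Omega> u x $ i) \<in> H1 \<Omega>}"

text \<open>\<open>H\<^sup>1\<^sup>/\<^sup>2(\<partial>\<Omega>)\<close> through the Gagliardo seminorm: the exponent \<open>(d - 1) + 2 \<cdot> 1/2\<close> is \<open>d\<close>.\<close>

definition H_half :: "(real^'d) set \<Rightarrow> (real^'d \<Rightarrow> real) set" where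
  "H_half \<Omega> = {g \<in> L2 (surface_measure \<Omega>).
     (\<integral>\<^sup>+x. (\<integral>\<^sup>+y. ennreal ((g x - g y)\<^sup>2 / norm (x - y) ^ CARD('d)) \<partial>surface_measure \<Omega>)
        \<partial>surface_measure \<Omega>) < \<infinity>}"

text \<open>The bounded linear operator from \<open>H\<^sup>1(\<Omega>)\<close> to \<open>L\<^sup>2(\<partial>\<Omega>)\<close> that restricts functions
  continuous up to the boundary; for the domains considered here it exists and is unique up to
  null sets.\<close>

definition is_trace_operator ::
  "(real^'d) set \<Rightarrow> ((real^'d \<Rightarrow> real) \<Rightarrow> real^'d \<Rightarrow> real) \<Rightarrow> bool" where
  "is_trace_operator \<Omega> Tr \<longleftrightarrow>
     (\<forall>u\<in>H1 \<Omega>. Tr u \<in> L2 (surface_measure \<Omega>)) \<and>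
     (\<forall>u\<in>H1 \<Omega>. \<forall>v\<in>H1 \<Omega>. \<forall>a b. AE x in surface_measure \<Omega>.
        Tr (\<lambda>x. a * u x + b * v x) x = a * Tr u x + b * Tr v x) \<and>
     (\<exists>C. \<forall>u\<in>H1 \<Omega>. L2_norm (surface_measure \<Omega>) (Tr u) \<le> C * H1_norm \<Omega> u) \<and>
     (\<forall>u\<in>H1 \<Omega>. continuous_on (closure \<Omega>) u \<longrightarrow> (AE x in surface_measure \<Omega>. Tr u x = u x))"


section \<open>The Neumann problem and the Ritz losses\<close>

definition neumann_weak_solution ::
  "(real^'d) set \<Rightarrow> ((real^'d \<Rightarrow> real) \<Rightarrow> real^'d \<Rightarrow> real) \<Rightarrow>
   (real^'d \<Rightarrow> real) \<Rightarrow> (real^'d \<Rightarrow> real) \<Rightarrow> (real^'d \<Rightarrow> real) \<Rightarrow> (real^'d \<Rightarrow> real) \<Rightarrow> bool" where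
  "neumann_weak_solution \<Omega> Tr \<omega> h g u \<longleftrightarrow>
     u \<in> H1 \<Omega> \<and>
     (\<forall>v\<in>H1 \<Omega>.
        (LINT x|lebesgue_on \<Omega>. weak_grad \<Omega> u x \<bullet> weak_grad \<Omega> v x + \<omega> x * u x * v x) =
        (LINT x|lebesgue_on \<Omega>. h x * v x) + (LINT x|surface_measure \<Omega>. g x * Tr v x))"

definition ritz_loss ::
  "(real^'d) set \<Rightarrow> ((real^'d \<Rightarrow> real) \<Rightarrow> real^'d \<Rightarrow> real) \<Rightarrow>
   (real^'d \<Rightarrow> real) \<Rightarrow> (real^'d \<Rightarrow> real) \<Rightarrow> (real^'d \<Rightarrow> real) \<Rightarrow> (real^'d \<Rightarrow> real) \<Rightarrow> real" where
  "ritz_loss \<Omega> Tr \<omega> h g u =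
     (LINT x|lebesgue_on \<Omega>.
        1/2 * (norm (weak_grad \<Omega> u x))\<^sup>2 + 1/2 * \<omega> x * (u x)\<^sup>2 - h x * u x) -
     (LINT x|surface_measure \<Omega>. g x * Tr u x)"

text \<open>\<open>X\<close> and \<open>Y\<close> are realised sample points, and \<open>u\<close> is a network, so that its
  gradient at \<open>X p\<close> is the classical one.\<close>

definition empirical_loss ::
  "(real^'d) set \<Rightarrow> (real^'d \<Rightarrow> real) \<Rightarrow> (real^'d \<Rightarrow> real) \<Rightarrow> (real^'d \<Rightarrow> real) \<Rightarrow>
   nat \<Rightarrow> nat \<Rightarrow> (nat \<Rightarrow> real^'d) \<Rightarrow> (nat \<Rightarrow> real^'d) \<Rightarrow> (real^'d \<Rightarrow> real) \<Rightarrow> real" where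
  "empirical_loss \<Omega> \<omega> h g N_in N_b X Y u =
     measure lebesgue \<Omega> / real N_in *
       (\<Sum>p<N_in. (norm (grad u (X p)))\<^sup>2 / 2 + \<omega> (X p) * (u (X p))\<^sup>2 / 2 - u (X p) * h (X p)) -
     measure (surface_measure \<Omega>) (frontier \<Omega>) / real N_b *
       (\<Sum>p<N_b. u (Y p) * g (Y p))"

text \<open>Extended-real valued, hence \<open>\<infinity>\<close> if one of the data is essentially unbounded.\<close>

definition data_bound ::
  "(real^'d) set \<Rightarrow> (real^'d \<Rightarrow> real) \<Rightarrow> (real^'d \<Rightarrow> real) \<Rightarrow> (real^'d \<Rightarrow> real) \<Rightarrow> ereal" where
  "data_bound \<Omega> \<omega> h g =
     Max {Linf_norm (lebesgue_on \<Omega>) h, Linf_norm (surface_measure \<Omega>) g, Linf_norm (lebesgue_on \<Omega>) \<omega>}"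


section \<open>Parallel tanh networks\<close>

text \<open>\<open>Weight l i j\<close> indexes the entry \<open>(i, j)\<close> of \<open>A\<^sub>l\<close> and \<open>Bias l i\<close> the entry \<open>i\<close> of \<open>b\<^sub>l\<close>
  (layers and neurons are counted from \<open>0\<close>).\<close>

datatype nn_index = Weight nat nat nat | Bias nat nat

definition nn_arch :: "nat \<Rightarrow> nat \<Rightarrow> (nat \<Rightarrow> nat) \<Rightarrow> bool" where
  "nn_arch d L N \<longleftrightarrow> 1 \<le> L \<and> N 0 = d \<and> N L = 1 \<and> (\<forall>l\<in>{1..<L}. 1 \<le> N l)"

definition nn_indices :: "nat \<Rightarrow> (nat \<Rightarrow> nat) \<Rightarrow> nn_index set" where
  "nn_indices L N = {Weight l i j |l i j. l < L \<and> i < N (Suc l) \<and> j < N l} \<union>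
                    {Bias l i |l i. l < L \<and> i < N (Suc l)}"

definition affine_layer :: "(nat \<Rightarrow> nat) \<Rightarrow> (nn_index \<Rightarrow> real) \<Rightarrow> nat \<Rightarrow> (nat \<Rightarrow> real) \<Rightarrow> nat \<Rightarrow> real" where
  "affine_layer N \<theta> l y i = (\<Sum>j<N l. \<theta> (Weight l i j) * y j) + \<theta> (Bias l i)"

text \<open>The coordinates of the input are enumerated by the bijection
  \<open>from_nat_into UNIV\<close> from \<open>{..<CARD('d)}\<close>.\<close>

primrec hidden_layer ::
  "(nat \<Rightarrow> nat) \<Rightarrow> (nn_index \<Rightarrow> real) \<Rightarrow> nat \<Rightarrow> real^'d \<Rightarrow> nat \<Rightarrow> real" where
  "hidden_layer N \<theta> 0 x j = x $ from_nat_into UNIV j"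
| "hidden_layer N \<theta> (Suc l) x j = tanh (affine_layer N \<theta> l (hidden_layer N \<theta> l x) j)"

definition network ::
  "nat \<Rightarrow> (nat \<Rightarrow> nat) \<Rightarrow> (nn_index \<Rightarrow> real) \<Rightarrow> real^'d \<Rightarrow> real" where
  "network L N \<theta> x = affine_layer N \<theta> (L - 1) (hidden_layer N \<theta> (L - 1) x) 0"

text \<open>The bound \<open>W\<close> applies to the hidden layers. Padding with zero weights shows that requiring
  all hidden widths to equal \<open>W\<close>, or their maximum to equal \<open>W\<close>, gives the same class
  when \<open>L \<ge> 2\<close> and \<open>W\<close>, \<open>B\<close> are admissible (\<open>W \<ge> 1\<close>, \<open>B \<ge> 0\<close>).\<close>

definition NN :: "nat \<Rightarrow> nat \<Rightarrow> real \<Rightarrow> (real^'d \<Rightarrow> real) set" where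
  "NN W L B = {network L N \<theta> |N \<theta>.
     nn_arch CARD('d) L N \<and> (\<forall>l\<in>{1..<L}. N l \<le> W) \<and> (\<forall>q\<in>nn_indices L N. \<bar>\<theta> q\<bar> \<le> B)}"

definition PNN :: "nat \<Rightarrow> real \<Rightarrow> nat \<Rightarrow> nat \<Rightarrow> real \<Rightarrow> (real^'d \<Rightarrow> real) set" where
  "PNN m M W L B = {\<lambda>x. \<Sum>k<m. c k * \<phi> k x |c \<phi>.
     (\<forall>k<m. \<exists>W' L' B'. W' \<le> W \<and> L' \<le> L \<and> B' \<le> B \<and> \<phi> k \<in> NN W' L' B') \<and>
     (\<Sum>k<m. \<bar>c k\<bar>) \<le> M}"


section \<open>Projected gradient descent\<close>

text \<open>A parameter vector assigns a real to each index in \<open>inner_params \<union> outer_params\<close>; values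
  at other indices play no role. Sub-network \<open>k\<close> has depth \<open>L k\<close> and layer widths \<open>N k\<close>.\<close>

datatype pnn_index = Inner nat nn_index | Outer nat

definition inner_params :: "nat \<Rightarrow> (nat \<Rightarrow> nat) \<Rightarrow> (nat \<Rightarrow> nat \<Rightarrow> nat) \<Rightarrow> pnn_index set" where
  "inner_params m L N = {Inner k q |k q. k < m \<and> q \<in> nn_indices (L k) (N k)}"

definition outer_params :: "nat \<Rightarrow> pnn_index set" where
  "outer_params m = Outer ` {..<m}"

definition parallel_network ::
  "nat \<Rightarrow> (nat \<Rightarrow> nat) \<Rightarrow> (nat \<Rightarrow> nat \<Rightarrow> nat) \<Rightarrow> (pnn_index \<Rightarrow> real) \<Rightarrow> real^'d \<Rightarrow> real" where
  "parallel_network m L N \<theta> x =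
     (\<Sum>k<m. \<theta> (Outer k) * network (L k) (N k) (\<lambda>q. \<theta> (Inner k q)) x)"

definition param_partial ::
  "((pnn_index \<Rightarrow> real) \<Rightarrow> real) \<Rightarrow> (pnn_index \<Rightarrow> real) \<Rightarrow> pnn_index \<Rightarrow> real" where
  "param_partial F \<theta> q = deriv (\<lambda>t. F (\<theta>(q := t))) (\<theta> q)"

definition is_euclidean_projection ::
  "'i set \<Rightarrow> ('i \<Rightarrow> real) set \<Rightarrow> ('i \<Rightarrow> real) \<Rightarrow> ('i \<Rightarrow> real) \<Rightarrow> bool" where
  "is_euclidean_projection I K z y \<longleftrightarrow>
     is_arg_min (\<lambda>y. L2_set (\<lambda>q. y q - z q) I) (\<lambda>y. y \<in> K) y"

text \<open>\<open>F\<close> is the loss as a function of the parameters.\<close>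

definition pgd_run ::
  "nat \<Rightarrow> (nat \<Rightarrow> nat) \<Rightarrow> (nat \<Rightarrow> nat \<Rightarrow> nat) \<Rightarrow> ((pnn_index \<Rightarrow> real) \<Rightarrow> real) \<Rightarrow>
   real \<Rightarrow> real \<Rightarrow> real \<Rightarrow> nat \<Rightarrow> (nat \<Rightarrow> pnn_index \<Rightarrow> real) \<Rightarrow> bool" where
  "pgd_run m L N F lam \<eta> \<zeta> T \<theta> \<longleftrightarrow>
     (\<forall>q\<in>outer_params m. \<theta> 0 q = 0) \<and>
     (\<forall>t<T. is_euclidean_projection (inner_params m L N \<union> outer_params m)
        {\<psi>. L2_set (\<lambda>q. \<psi> q - \<theta> 0 q) (inner_params m L N) \<le> \<eta> \<and>
            (\<Sum>q\<in>outer_params m. \<bar>\<psi> q\<bar>) \<le> \<zeta>}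
        (\<lambda>q. \<theta> t q - lam * param_partial F (\<theta> t) q)
        (\<theta> (Suc t)))"

text \<open>Independent random variables, each uniformly distributed on \<open>A\<close> with respect to \<open>\<mu>\<close>.\<close>

definition iid_uniform ::
  "'w measure \<Rightarrow> 'a::topological_space measure \<Rightarrow> 'a set \<Rightarrow> ('i \<Rightarrow> 'w \<Rightarrow> 'a) \<Rightarrow> 'i set \<Rightarrow> bool" where
  "iid_uniform P \<mu> A X I \<longleftrightarrow>
     prob_space.indep_vars P (\<lambda>_. borel) X I \<and>
     (\<forall>i\<in>I. distr P borel (X i) = uniform_measure \<mu> A)"

end

theory Submission
  imports Defs
begin

text \<open>The estimate is the classical splitting of the error of an empirical risk minimisation into
  approximation, optimisation and statistical errors, combined with the fact that the excess Ritz
  loss is equivalent to the squared \<open>H\<^sup>1\<close> distance to the solution. Write \<open>L\<close> for the Ritz loss.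

  Since \<open>u0\<close> solves the weak formulation, expanding the quadratic functional \<open>L\<close> around \<open>u0\<close> leaves
  no linear term, and \<open>L u - L u0\<close> is one half of the integral of \<open>\<bar>\<nabla>w\<bar>\<^sup>2 + \<omega> w\<^sup>2\<close> for
  \<open>w = u - u0\<close> (\<open>ritz_loss_excess_eq_energy\<close>). The lower bound \<open>c0\<close> on \<open>\<omega>\<close> bounds the squared
  \<open>H\<^sup>1\<close> norm of \<open>w\<close> by the excess (\<open>ritz_loss_excess_lower\<close>), and the essential upper bound on \<open>\<omega>\<close> gives
  the converse (\<open>ritz_loss_excess_upper\<close>). The first bound is applied to the algorithm's output, the
  second to the best approximation \<open>ubar\<close>. In between, both exact losses are replaced by empirical
  ones, which costs twice the supremum over the class that contains both functions.

  Most of the work is to justify the expansion. It needs the networks to lie in \<open>H\<^sup>1\<close>, which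
  follows from integration by parts for \<open>C\<^sup>1\<close> functions (\<open>C1_has_weak_grad\<close>), itself a consequence
  of the translation invariance of Lebesgue measure. And it needs the chosen weak gradient of
  \<open>u - u0\<close> to be the difference of the chosen weak gradients. This is uniqueness of weak gradients
  (\<open>weak_grad_unique\<close>), that is, the fundamental lemma of the calculus of variations, for which
  explicit smooth bump functions on boxes are constructed.\<close>

section \<open>Calculus of \<open>C\<^sup>k\<close> functions\<close>

lemma partial_eq_derivative_axis: "(f has_derivative D) (at x) \<Longrightarrow> partial i f x = D (axis i 1)"
  unfolding partial_def using frechet_derivative_at by metis

text \<open>Working with the derivative as a linear map lets the chain and product rules of the
  library be used directly; the partial derivatives are its values on the axes.\<close>

lemma Ck_SucI:
  assumes "\<And>x. (f has_derivative D x) (at x)" "\<And>i. Ck k (\<lambda>x. D x (axis i 1))"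
  shows "Ck (Suc k) f"
proof -
  have "partial i f = (\<lambda>x. D x (axis i 1))" for i
    using partial_eq_derivative_axis[OF assms(1)] by blast
  then show ?thesis using assms by (auto simp: differentiable_def)
qed

lemma Ck_Suc_derivative:
  assumes "Ck (Suc k) f"
  shows "(f has_derivative frechet_derivative f (at x)) (at x)"
  using assms frechet_derivative_works by auto

lemma Ck_Suc_imp_Ck: "Ck (Suc k) f \<Longrightarrow> Ck k f"
proof (induction k arbitrary: f)
  case 0
  then show ?case
    by (auto intro!: continuous_at_imp_continuous_on differentiable_imp_continuous_within)
qed auto

lemma Ck_imp_continuous: "Ck k f \<Longrightarrow> continuous_on UNIV f"
  by (induction k) (simp, metis Ck.simps(1) Ck_Suc_imp_Ck)

lemma Ck_const: "Ck k (\<lambda>x. c)"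
proof (induction k arbitrary: c)
  case (Suc k)
  then show ?case by (intro Ck_SucI[where D="\<lambda>x v. 0"]) auto
qed simp

lemma Ck_add:
  "Ck k f \<Longrightarrow> Ck k g \<Longrightarrow> Ck k (\<lambda>x. f x + g x)"
proof (induction k arbitrary: f g)
  case 0
  then show ?case by (simp add: continuous_on_add)
next
  case (Suc k)
  show ?case
  proof (rule Ck_SucI)
    show "((\<lambda>x. f x + g x) has_derivative
        (\<lambda>v. frechet_derivative f (at x) v + frechet_derivative g (at x) v)) (at x)" for x
      using Ck_Suc_derivative[OF Suc.prems(1)] Ck_Suc_derivative[OF Suc.prems(2)]
      by (rule has_derivative_add)
    show "Ck k (\<lambda>x. frechet_derivative f (at x) (axis i 1) + frechet_derivative g (at x) (axis i 1))" for i
      using Suc by (auto simp: partial_def [abs_def])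
  qed
qed

text \<open>The induction needs both factors at level \<open>k\<close> as well as their partial
  derivatives, because the product rule mixes a function with the derivative of the other.\<close>

lemma Ck_mult:
  "Ck k f \<Longrightarrow> Ck k g \<Longrightarrow> Ck k (\<lambda>x. f x * g x)"
proof (induction k arbitrary: f g)
  case 0
  then show ?case by (simp add: continuous_on_mult)
next
  case (Suc k)
  show ?case
  proof (rule Ck_SucI)
    show "((\<lambda>x. f x * g x) has_derivative
        (\<lambda>v. f x * frechet_derivative g (at x) v + frechet_derivative f (at x) v * g x)) (at x)" for x
      using Ck_Suc_derivative[OF Suc.prems(1)] Ck_Suc_derivative[OF Suc.prems(2)]
      by (rule has_derivative_mult)
    show "Ck k (\<lambda>x. f x * frechet_derivative g (at x) (axis i 1) + frechet_derivative f (at x) (axis i 1) * g x)" for i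
      using Suc Ck_Suc_imp_Ck[of k] by (intro Ck_add Suc.IH) (auto simp: partial_def [abs_def])
  qed
qed

lemma Ck_sum: "(\<And>j. j \<in> J \<Longrightarrow> Ck k (f j)) \<Longrightarrow> Ck k (\<lambda>x. \<Sum>j\<in>J. f j x)"
  by (induction J rule: infinite_finite_induct) (auto intro: Ck_const Ck_add)

lemma Ck_prod: "(\<And>j. j \<in> J \<Longrightarrow> Ck k (f j)) \<Longrightarrow> Ck k (\<lambda>x. \<Prod>j\<in>J. f j x)"
  by (induction J rule: infinite_finite_induct) (auto intro: Ck_const Ck_mult)

lemma Ck_coordinate: "Ck k (\<lambda>x. x $ j)"
proof (cases k)
  case (Suc n)
  have "Ck (Suc n) (\<lambda>x. x $ j)"
    by (rule Ck_SucI[where D="\<lambda>x v. v $ j"])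
       (auto intro: Ck_const bounded_linear_imp_has_derivative bounded_linear_vec_nth)
  then show ?thesis by (simp only: Suc)
qed (simp add: continuous_on_component)

lemma C1_tanh:
  assumes "Ck (Suc 0) f" shows "Ck (Suc 0) (\<lambda>x. tanh (f x))"
proof (rule Ck_SucI)
  show "((\<lambda>x. tanh (f x)) has_derivative
      (\<lambda>v. (1 - (tanh (f x))\<^sup>2) * frechet_derivative f (at x) v)) (at x)" for x
    using has_derivative_compose[OF Ck_Suc_derivative[OF assms]
        has_field_derivative_imp_has_derivative[OF has_field_derivative_tanh[OF _ DERIV_ident]]]
    by (auto simp: o_def)
  have "continuous_on UNIV f"
    using assms by (rule Ck_imp_continuous)
  then show "Ck 0 (\<lambda>x. (1 - (tanh (f x))\<^sup>2) * frechet_derivative f (at x) (axis i 1))" for i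
    using assms by (auto simp: partial_def[abs_def] intro!: continuous_intros)
qed

section \<open>Smooth bump functions on boxes\<close>

text \<open>The function \<open>p(1/t) exp(-1/t)\<close>, extended by zero to \<open>t \<le>
  0\<close>. Carrying the polynomial \<open>p\<close> along makes the family closed under
  differentiation, so that smoothness at the flat point \<open>0\<close> can be proved for all
  derivatives at once.\<close>

definition flat_exp :: "real poly \<Rightarrow> real \<Rightarrow> real" where
  "flat_exp p t = (if t \<le> 0 then 0 else poly p (1 / t) * exp (- (1 / t)))"

lemma power_mult_poly_div_exp_tendsto_0:
  fixes p :: "real poly"
  shows "((\<lambda>s. s ^ k * poly p s / exp s) \<longlongrightarrow> 0) at_top"
proof (induction p arbitrary: k)
  case (pCons a p)
  have "((\<lambda>s. a * (s ^ k / exp s) + s ^ Suc k * poly p s / exp s) \<longlongrightarrow> a * 0 + 0) at_top"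
    by (intro tendsto_intros tendsto_power_div_exp_0 pCons.IH)
  then show ?case by (simp add: algebra_simps add_divide_distrib)
qed simp

text \<open>Substituting \<open>s = 1/t\<close>, this is the fact that the exponential outgrows
  every polynomial.\<close>

lemma flat_exp_tendsto_0: "(flat_exp p \<longlongrightarrow> 0) (at 0)"
proof (rule filterlim_split_at)
  show "(flat_exp p \<longlongrightarrow> 0) (at_left 0)"
    by (rule tendsto_eventually) (auto simp: flat_exp_def eventually_at_filter)
  have "((\<lambda>s. flat_exp p (inverse s)) \<longlongrightarrow> 0) at_top"
    by (rule Lim_transform_eventually[OF power_mult_poly_div_exp_tendsto_0[of 0 p]])
       (auto intro!: eventually_at_top_linorderI[of 1] simp: flat_exp_def exp_minus divide_simps)
  then show "(flat_exp p \<longlongrightarrow> 0) (at_right 0)"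
    by (simp add: filterlim_at_right_to_top)
qed

text \<open>Away from \<open>0\<close> this is the chain rule: with \<open>s = 1/t\<close> one has
  \<open>ds/dt = -s\<^sup>2\<close>, hence the factor \<open>s\<^sup>2 (p - p')\<close>. At
  \<open>0\<close> the difference quotient is again a member of the family, the one with
  polynomial \<open>s p(s)\<close>, and therefore tends to \<open>0\<close>.\<close>

lemma DERIV_flat_exp: "(flat_exp p has_real_derivative flat_exp ([:0, 0, 1:] * (p - pderiv p)) t) (at t)"
proof -
  consider "t < 0" | "t = 0" | "t > 0" by linarith
  then show ?thesis
  proof cases
    case 1
    then have "eventually (\<lambda>s. s < 0) (nhds t)" 
      by (intro eventually_nhds_in_open[of "{..<0}", simplified]) auto
    then have "eventually (\<lambda>s. flat_exp p s = 0) (nhds t)" 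
      by eventually_elim (simp add: flat_exp_def)
    then have "(flat_exp p has_real_derivative 0) (at t) \<longleftrightarrow> ((\<lambda>s. 0) has_real_derivative 0) (at t)"
      by (intro DERIV_cong_ev) auto
    then show ?thesis using 1 by (simp add: flat_exp_def)
  next
    case 2
    have "((\<lambda>h. flat_exp (pCons 0 p) h) \<longlongrightarrow> 0) (at 0)" by (rule flat_exp_tendsto_0)
    then have "((\<lambda>h. flat_exp p h / h) \<longlongrightarrow> 0) (at 0)"
      by (rule Lim_transform_eventually) (auto simp: eventually_at_filter flat_exp_def)
    then show ?thesis using 2 by (simp add: DERIV_def flat_exp_def)
  next
    case 3
    then have "eventually (\<lambda>s. 0 < s) (nhds t)" 
      by (intro eventually_nhds_in_open[of "{0<..}", simplified]) auto
    then have "eventually (\<lambda>s. flat_exp p s = poly p (1 / s) * exp (- (1 / s))) (nhds t)" 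
      by eventually_elim (simp add: flat_exp_def)
    moreover have "((\<lambda>s. poly p (1 / s) * exp (- (1 / s))) has_real_derivative
        flat_exp ([:0, 0, 1:] * (p - pderiv p)) t) (at t)"
      using 3 by (auto intro!: derivative_eq_intros DERIV_chain'[OF _ poly_DERIV]
          simp: flat_exp_def field_simps power2_eq_square)
    ultimately show ?thesis
      by (subst DERIV_cong_ev[OF refl _ refl]) auto
  qed
qed

lemma Ck_flat_exp: "Ck k (\<lambda>x. c * flat_exp p (a * x $ j + b))"
proof (induction k arbitrary: c p)
  case 0
  have "continuous_on UNIV (flat_exp p)" 
    using DERIV_flat_exp by (meson DERIV_isCont continuous_at_imp_continuous_on)
  then have "continuous_on UNIV (\<lambda>x::real^'a. flat_exp p (a * x $ j + b))"
    by (rule continuous_on_compose2) (auto intro!: continuous_intros)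
  then show ?case by (auto intro!: continuous_intros)
next
  case (Suc k)
  let ?q = "[:0, 0, 1:] * (p - pderiv p)"
  show ?case
  proof (rule Ck_SucI[where D="\<lambda>x v. c * (flat_exp ?q (a * x $ j + b) * (a * v $ j))"])
    have "((\<lambda>x::real^'a. a * x $ j + b) has_derivative (\<lambda>v. a * v $ j)) (at x)" for x
      by (auto intro!: derivative_eq_intros bounded_linear_imp_has_derivative bounded_linear_vec_nth)
    from has_derivative_compose[OF this has_field_derivative_imp_has_derivative[OF DERIV_flat_exp]]
    show "((\<lambda>x::real^'a. c * flat_exp p (a * x $ j + b)) has_derivative
        (\<lambda>v. c * (flat_exp ?q (a * x $ j + b) * (a * v $ j)))) (at x)" for x
      by (intro has_derivative_mult_right) (simp add: mult.commute)
    have "(\<lambda>x. c * (flat_exp ?q (a * x $ j + b) * (a * axis i 1 $ j))) =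
        (\<lambda>x. (c * (a * axis i 1 $ j)) * flat_exp ?q (a * x $ j + b))" for i
      by (auto simp: mult_ac)
    then show "Ck k (\<lambda>x. c * (flat_exp ?q (a * x $ j + b) * (a * axis i 1 $ j)))" for i
      using Suc by metis
  qed
qed

text \<open>A bump that is positive exactly on the open box. Each factor is \<open>exp(-1/((n+1)
  c))\<close> for the distance \<open>c\<close> to a face, so rescaling by \<open>n + 1\<close>
  drives it to \<open>1\<close> without moving the support.\<close>

definition box_bump :: "real^'d \<Rightarrow> real^'d \<Rightarrow> nat \<Rightarrow> real^'d \<Rightarrow> real" where
  "box_bump a b n x = (\<Prod>i\<in>UNIV. flat_exp 1 (real (Suc n) * (x $ i - a $ i)) * flat_exp 1 (real (Suc n) * (b $ i - x $ i)))"

lemma Ck_box_bump: "Ck k (box_bump a b n)"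
proof -
  define c where "c = real (Suc n)"
  have "Ck k (\<lambda>x. \<Prod>i\<in>UNIV. (1 * flat_exp 1 (c * x $ i + - (c * a $ i))) * (1 * flat_exp 1 (- c * x $ i + c * b $ i)))"
    by (intro Ck_prod Ck_mult Ck_flat_exp)
  moreover have "box_bump a b n =
      (\<lambda>x. \<Prod>i\<in>UNIV. (1 * flat_exp 1 (c * x $ i + - (c * a $ i))) * (1 * flat_exp 1 (- c * x $ i + c * b $ i)))"
    unfolding box_bump_def c_def[symmetric] by (simp add: right_diff_distrib fun_eq_iff)
  ultimately show ?thesis by (simp only:)
qed

lemma box_bump_bounds: "0 \<le> box_bump a b n x" "box_bump a b n x \<le> 1"
  unfolding box_bump_def by (auto intro!: prod_nonneg prod_le_1 mult_le_one simp: flat_exp_def)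

lemma box_bump_outside: "x \<notin> box a b \<Longrightarrow> box_bump a b n x = 0"
  unfolding box_bump_def mem_box_cart by (auto simp: flat_exp_def mult_le_0_iff not_less)

lemma box_bump_tendsto: "(\<lambda>n. box_bump a b n x) \<longlonglongrightarrow> indicator (box a b) x"
proof (cases "x \<in> box a b")
  case True
  have *: "(\<lambda>n. flat_exp 1 (real (Suc n) * c)) \<longlonglongrightarrow> 1" if "c > 0" for c
  proof -
    have "(\<lambda>n. exp (- (1 / c * inverse (real (Suc n))))) \<longlonglongrightarrow> exp (- (1 / c * 0))"
      by (intro tendsto_intros LIMSEQ_inverse_real_of_nat)
    moreover have "flat_exp 1 (real (Suc n) * c) = exp (- (1 / c * inverse (real (Suc n))))" for n
      using that by (auto simp: flat_exp_def not_le divide_simps mult_le_0_iff)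
    ultimately show ?thesis by simp
  qed
  have "(\<lambda>n. box_bump a b n x) \<longlonglongrightarrow> (\<Prod>i::'a\<in>UNIV. 1 * 1)"
    unfolding box_bump_def by (intro tendsto_prod tendsto_mult *) (use True in \<open>auto simp: mem_box_cart\<close>)
  then show ?thesis using True by simp
qed (simp add: box_bump_outside)

lemma box_bump_test_function:
  assumes "cbox a b \<subseteq> \<Omega>" shows "box_bump a b n \<in> test_functions \<Omega>"
proof -
  have "{x. box_bump a b n x \<noteq> 0} \<subseteq> cbox a b"
    using box_bump_outside box_subset_cbox by blast
  then have *: "closure {x. box_bump a b n x \<noteq> 0} \<subseteq> cbox a b"
    by (rule closure_minimal) (rule closed_cbox)
  then have "compact (closure {x. box_bump a b n x \<noteq> 0})"
    using bounded_subset[OF bounded_cbox] closed_closure compact_eq_bounded_closed by blast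
  then show ?thesis unfolding test_functions_def using * assms Ck_box_bump by blast
qed

section \<open>The fundamental lemma and uniqueness of weak gradients\<close>

text \<open>Open boxes form an intersection-stable generator of the Borel sets, and the sets over
  which an integrable function has integral zero form a Dynkin system once the integral over the
  whole space vanishes. An integrable function whose integrals over all Borel sets vanish is zero
  almost everywhere.\<close>

lemma AE_0_if_box_integrals_0:
  fixes f :: "'a::euclidean_space \<Rightarrow> real"
  assumes int: "integrable lebesgue f"
    and total: "(LINT x|lebesgue. f x) = 0"
    and boxes: "\<And>a b. (LINT x:box a b|lebesgue. f x) = 0"
  shows "AE x in lebesgue. f x = 0"
proof -
  \<comment> \<open>The induction runs over Borel sets, so the Lebesgue measurable function is
      first replaced by a Borel measurable representative.\<close>
  obtain f' where f'[measurable]: "f' \<in> borel_measurable lborel" and "AE x in lborel. f x = f' x"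
    using completion_ex_borel_measurable_real[OF borel_measurable_integrable[OF int]] by auto
  then have ae: "AE x in lebesgue. f x = f' x"
    by (simp add: AE_completion_iff)
  have int': "integrable lborel f'"
  proof -
    have "integrable lebesgue f'"
      using ae int f' by (subst integrable_cong_AE[symmetric, of f]) (auto simp: measurable_completion)
    then show ?thesis using f' by (simp add: integrable_completion)
  qed
  have transfer: "(LINT x:A|lborel. f' x) = (LINT x:A|lebesgue. f x)" if A[measurable]: "A \<in> sets borel" for A
  proof -
    have "(LINT x:A|lborel. f' x) = (LINT x:A|lebesgue. f' x)"
      unfolding set_lebesgue_integral_def by (rule integral_completion[symmetric]) simp
    also have "\<dots> = (LINT x:A|lebesgue. f x)"
      unfolding set_lebesgue_integral_def
    proof (rule integral_cong_AE)
      have A': "A \<in> sets lebesgue" using A by simp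
      show "(\<lambda>x. indicat_real A x *\<^sub>R f' x) \<in> borel_measurable lebesgue"
        by (rule measurable_completion) measurable
      show "(\<lambda>x. indicat_real A x *\<^sub>R f x) \<in> borel_measurable lebesgue"
        using integrable_mult_indicator[OF A' int] by (rule borel_measurable_integrable)
      show "AE x in lebesgue. indicat_real A x *\<^sub>R f' x = indicat_real A x *\<^sub>R f x"
        using ae by eventually_elim simp
    qed
    finally show ?thesis .
  qed
  have UNIV0: "(LINT x:UNIV|lborel. f' x) = 0"
    using total by (subst transfer) (auto simp: set_lebesgue_integral_def)
  have set_int: "set_integrable lborel A f'" if "A \<in> sets borel" for A
    using integrable_mult_indicator[of A lborel f'] int' that by (simp add: set_integrable_def)
  have zero: "(LINT x:A|lborel. f' x) = 0" if "A \<in> sets borel" for A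
  proof -
    have "Int_stable (range (\<lambda>(a, b). box a b :: 'a set))"
      by (auto simp: Int_stable_def box_Int_box)
    moreover have "range (\<lambda>(a, b). box a b :: 'a set) \<subseteq> Pow UNIV" by simp
    moreover have "A \<in> sigma_sets UNIV (range (\<lambda>(a, b). box a b))"
      using that unfolding borel_eq_box by simp
    ultimately show ?thesis
    proof (induction rule: sigma_sets_induct_disjoint)
      case (basic A)
      then show ?case using boxes transfer by auto
    next
      case empty
      then show ?case by (simp add: set_lebesgue_integral_def)
    next
      case (compl A)
      then have A: "A \<in> sets borel" by (simp add: borel_eq_box)
      then have "(LINT x:UNIV|lborel. f' x) = (LINT x:A|lborel. f' x) + (LINT x:UNIV - A|lborel. f' x)"
        by (subst set_integral_Un[symmetric]) (auto intro!: set_int)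
      then show ?case using UNIV0 compl by simp
    next
      case (union A)
      then have A: "A i \<in> sets borel" for i by (auto simp: borel_eq_box)
      then have "(LINT x:(\<Union>i. A i)|lborel. f' x) = (\<Sum>i. (LINT x:A i|lborel. f' x))"
        using union(1) by (intro lebesgue_integral_countable_add set_int) (auto simp: disjoint_family_on_def)
      then show ?case using union by simp
    qed
  qed
  have "AE x in lborel. f' x = 0"
  proof (rule density_unique_real[OF int'])
    show "integrable lborel (\<lambda>x::'a. 0::real)" by simp
    show "(LINT x:A|lborel. f' x) = (LINT x:A|lborel. 0)" if "A \<in> sets lborel" for A
      using zero[of A] that by (simp add: set_lebesgue_integral_def)
  qed
  then have "AE x in lebesgue. f' x = 0" by (simp add: AE_completion_iff)
  with ae show ?thesis by eventually_elim simp
qed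

lemma integral_lebesgue_on:
  fixes f :: "'a::euclidean_space \<Rightarrow> real"
  assumes "S \<in> sets lebesgue"
  shows "(LINT x|lebesgue_on S. f x) = (LINT x|lebesgue. indicator S x * f x)"
    "integrable (lebesgue_on S) f \<longleftrightarrow> integrable lebesgue (\<lambda>x. indicator S x * f x)"
  using assms by (simp_all add: integral_restrict_space integrable_restrict_space)

lemma integrable_lebesgue_on_superset:
  fixes f :: "'a::euclidean_space \<Rightarrow> real"
  assumes "integrable (lebesgue_on K) f" "K \<subseteq> S" "S \<in> sets lebesgue" "K \<in> sets lebesgue"
    and "\<And>x. x \<notin> K \<Longrightarrow> f x = 0"
  shows "integrable (lebesgue_on S) f"
proof -
  have "(\<lambda>x. indicator S x * f x) = (\<lambda>x. indicator K x * f x)"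
    using assms by (auto simp: indicator_def fun_eq_iff)
  then show ?thesis
    using assms(1) unfolding integral_lebesgue_on[OF assms(3)] integral_lebesgue_on[OF assms(4)] by (simp only:)
qed

text \<open>On the complement of the closed support, which is open, the function vanishes
  identically, and so do its partial derivatives.\<close>

lemma test_function_support:
  assumes "\<phi> \<in> test_functions \<Omega>"
  obtains K where "compact K" "K \<subseteq> \<Omega>" "\<And>x. x \<notin> K \<Longrightarrow> \<phi> x = 0" "\<And>x i. x \<notin> K \<Longrightarrow> partial i \<phi> x = 0"
    "\<And>k. Ck k \<phi>"
proof
  let ?K = "closure {x. \<phi> x \<noteq> 0}"
  show K: "compact ?K" "?K \<subseteq> \<Omega>" "\<And>k. Ck k \<phi>" using assms by (auto simp: test_functions_def)
  show out: "\<phi> x = 0" if "x \<notin> ?K" for x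
    using that subsetD[OF closure_subset, of x "{x. \<phi> x \<noteq> 0}"] by auto
  show "partial i \<phi> x = 0" if "x \<notin> ?K" for x i
  proof -
    have "(\<phi> has_derivative (\<lambda>v. 0)) (at x)"
    proof (rule has_derivative_transform_within_open[OF has_derivative_const])
      show "open (- ?K)" by (rule open_Compl[OF closed_closure])
      show "x \<in> - ?K" unfolding Compl_iff by (rule that)
      show "0 = \<phi> y" if "y \<in> - ?K" for y using out that unfolding Compl_iff by metis
    qed
    then show ?thesis by (simp add: partial_eq_derivative_axis)
  qed
qed

text \<open>A locally integrable function times a continuous one with compact support in
  \<open>\<Omega>\<close> is controlled on that support, so all integrals occurring in the
  definition of a weak gradient exist and can be added.\<close>

lemma integrable_mult_compact_support:
  fixes f \<psi> :: "real^'d \<Rightarrow> real"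
  assumes f: "locally_integrable \<Omega> f" and "\<Omega> \<in> sets lebesgue"
    and \<psi>: "continuous_on UNIV \<psi>" "compact K" "K \<subseteq> \<Omega>" "\<And>x. x \<notin> K \<Longrightarrow> \<psi> x = 0"
  shows "integrable (lebesgue_on \<Omega>) (\<lambda>x. f x * \<psi> x)"
proof -
  have "bounded (\<psi> ` K)"
    using \<psi> by (intro compact_imp_bounded compact_continuous_image) (auto intro: continuous_on_subset)
  then obtain C where C: "\<And>x. x \<in> K \<Longrightarrow> \<bar>\<psi> x\<bar> \<le> C" by (auto simp: bounded_iff)
  have K: "K \<in> sets lebesgue" using \<psi> by (simp add: borel_compact)
  have \<psi>m[measurable]: "\<psi> \<in> borel_measurable (lebesgue_on K)"
    using \<psi> by (intro continuous_imp_measurable_on_sets_lebesgue K) (auto intro: continuous_on_subset)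
  have fi: "integrable (lebesgue_on K) f" using f \<psi> by (auto simp: locally_integrable_def)
  have "integrable (lebesgue_on K) (\<lambda>x. f x * \<psi> x)"
  proof (rule Bochner_Integration.integrable_bound)
    show "integrable (lebesgue_on K) (\<lambda>x. C * \<bar>f x\<bar>)" using fi by auto
    show "(\<lambda>x. f x * \<psi> x) \<in> borel_measurable (lebesgue_on K)" using fi by measurable
    show "AE x in lebesgue_on K. norm (f x * \<psi> x) \<le> norm (C * \<bar>f x\<bar>)"
    proof (rule AE_I2)
      fix x assume "x \<in> space (lebesgue_on K)"
      then have "\<bar>\<psi> x\<bar> \<le> \<bar>C\<bar>" using C[of x] by auto
      then show "norm (f x * \<psi> x) \<le> norm (C * \<bar>f x\<bar>)"
        by (simp add: abs_mult mult.commute mult_right_mono)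
    qed
  qed
  then show ?thesis
    by (rule integrable_lebesgue_on_superset) (use \<psi> assms(2) K in auto)
qed

text \<open>The fundamental lemma of the calculus of variations. The bumps on a box inside
  \<open>\<Omega>\<close> increase to its indicator, so dominated convergence turns orthogonality
  to test functions into vanishing box integrals; countably many such boxes cover
  \<open>\<Omega>\<close>.\<close>

lemma AE_0_if_orthogonal_to_test_functions:
  fixes f :: "real^'d \<Rightarrow> real"
  assumes "open \<Omega>" and f: "locally_integrable \<Omega> f"
    and orth: "\<And>\<phi>. \<phi> \<in> test_functions \<Omega> \<Longrightarrow> (LINT x|lebesgue_on \<Omega>. f x * \<phi> x) = 0"
  shows "AE x in lebesgue_on \<Omega>. f x = 0"
proof -
  have \<Omega>: "\<Omega> \<in> sets lebesgue" using \<open>open \<Omega>\<close> by (simp add: borel_open)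
  have box0: "(LINT x:box a b|lebesgue. f x) = 0" if ab: "cbox a b \<subseteq> \<Omega>" for a b
  proof -
    have fi: "integrable lebesgue (\<lambda>x. indicator (cbox a b) x * f x)"
      using f ab integral_lebesgue_on(2)[of "cbox a b" f] by (simp add: locally_integrable_def)
    have lim: "(\<lambda>n. LINT x|lebesgue. (indicator (cbox a b) x * f x) * box_bump a b n x)
        \<longlonglongrightarrow> (LINT x|lebesgue. (indicator (cbox a b) x * f x) * indicator (box a b) x)"
    proof (rule integral_dominated_convergence[where w="\<lambda>x. norm (indicator (cbox a b) x * f x)"])
      show "integrable lebesgue (\<lambda>x. norm (indicator (cbox a b) x * f x))"
        using fi by (rule integrable_norm)
      have [measurable]: "(\<lambda>x. indicator (cbox a b) x * f x) \<in> borel_measurable lebesgue"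
        using fi by (rule borel_measurable_integrable)
      have [measurable]: "box a b \<in> sets lebesgue" by simp
      have [measurable]: "box_bump a b n \<in> borel_measurable lebesgue" for n
        by (rule measurable_completion) (simp add: borel_measurable_continuous_onI Ck_imp_continuous[OF Ck_box_bump])
      show "(\<lambda>x. (indicator (cbox a b) x * f x) * indicator (box a b) x) \<in> borel_measurable lebesgue"
        by measurable
      show "(\<lambda>x. (indicator (cbox a b) x * f x) * box_bump a b n x) \<in> borel_measurable lebesgue" for n
        by measurable
      show "AE x in lebesgue. (\<lambda>n. (indicator (cbox a b) x * f x) * box_bump a b n x)
          \<longlonglongrightarrow> (indicator (cbox a b) x * f x) * indicator (box a b) x"
        by (intro AE_I2 tendsto_mult_left box_bump_tendsto)
      show "AE x in lebesgue. norm ((indicator (cbox a b) x * f x) * box_bump a b n x)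
          \<le> norm (indicator (cbox a b) x * f x)" for n
        using box_bump_bounds[of a b n] by (intro AE_I2) (simp add: abs_mult mult_left_le)
    qed
    have "(LINT x|lebesgue. (indicator (cbox a b) x * f x) * box_bump a b n x) = 0" for n
    proof -
      have "(indicator (cbox a b) x * f x) * box_bump a b n x = indicator \<Omega> x * (f x * box_bump a b n x)" for x
        using ab box_bump_outside[of x a b n] box_subset_cbox[of a b] by (auto simp: indicator_def)
      then show ?thesis
        using orth[OF box_bump_test_function[OF ab, of n]] by (simp only: integral_lebesgue_on[OF \<Omega>])
    qed
    then have "(LINT x|lebesgue. (indicator (cbox a b) x * f x) * indicator (box a b) x) = 0"
      using lim LIMSEQ_unique by (auto simp: LIMSEQ_const_iff)
    moreover have "(indicator (cbox a b) x * f x) * indicator (box a b) x = indicator (box a b) x * f x" for x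
      using box_subset_cbox[of a b] by (auto simp: indicator_def)
    ultimately show ?thesis by (simp add: set_lebesgue_integral_def)
  qed
  have local: "AE x in lebesgue. x \<in> cbox c d \<longrightarrow> f x = 0" if cd: "cbox c d \<subseteq> \<Omega>" for c d
  proof -
    have "integrable lebesgue (\<lambda>x. indicator (cbox c d) x * f x)"
      using f cd integral_lebesgue_on(2)[of "cbox c d" f] by (simp add: locally_integrable_def)
    then have "integrable lebesgue (\<lambda>x. indicator (box c d) x *\<^sub>R (indicator (cbox c d) x * f x))"
      by (intro integrable_mult_indicator) auto
    moreover have "indicator (box c d) x *\<^sub>R (indicator (cbox c d) x * f x) = indicator (box c d) x * f x" for x
      using box_subset_cbox[of c d] by (auto simp: indicator_def)
    ultimately have "integrable lebesgue (\<lambda>x. indicator (box c d) x * f x)" by (simp only:)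
    moreover have "(LINT x|lebesgue. indicator (box c d) x * f x) = 0"
      using box0[OF cd] by (simp add: set_lebesgue_integral_def)
    moreover have "(LINT x:box a b|lebesgue. indicator (box c d) x * f x) = 0" for a b
    proof -
      \<comment> \<open>Open boxes intersect in an open box whose closed version is still inside
          the closed box chosen in \<open>\<Omega>\<close>.\<close>
      obtain p q where pq: "box a b \<inter> box c d = box p q" "cbox a b \<inter> cbox c d = cbox p q"
        unfolding box_Int_box Int_interval by blast
      have "indicator (box a b) x * (indicator (box c d) x * f x) = indicator (box p q) x * f x" for x
        unfolding pq(1)[symmetric] by (simp add: indicator_inter_arith)
      moreover have "(LINT x:box p q|lebesgue. f x) = 0" using cd pq(2) by (intro box0) auto
      ultimately show ?thesis by (simp only: set_lebesgue_integral_def real_scaleR_def)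
    qed
    ultimately have "AE x in lebesgue. indicator (box c d) x * f x = 0"
      by (rule AE_0_if_box_integrals_0)
    moreover have "AE x in lebesgue. x \<notin> cbox c d - box c d"
      using negligible_frontier_interval[of c d] by (intro AE_not_in) (simp add: negligible_iff_null_sets)
    ultimately show ?thesis by eventually_elim auto
  qed
  obtain \<D> where \<D>: "countable \<D>" "\<D> \<subseteq> Pow \<Omega>" "\<And>X. X \<in> \<D> \<Longrightarrow> \<exists>a b. X = cbox a b" "\<Union>\<D> = \<Omega>"
    using open_countable_Union_open_cbox[OF \<open>open \<Omega>\<close>] by blast
  have "AE x in lebesgue. \<forall>X\<in>\<D>. x \<in> X \<longrightarrow> f x = 0"
  proof (subst AE_ball_countable[OF \<D>(1)], rule ballI)
    fix X assume "X \<in> \<D>"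
    moreover from this obtain a b where "X = cbox a b" using \<D>(3) by blast
    ultimately show "AE x in lebesgue. x \<in> X \<longrightarrow> f x = 0" using local \<D>(2) by blast
  qed
  then have "AE x in lebesgue. x \<in> \<Omega> \<longrightarrow> f x = 0"
    by eventually_elim (use \<D>(4) in blast)
  then show ?thesis using \<Omega> by (simp add: AE_restrict_space_iff)
qed

text \<open>This makes statements about \<open>weak_grad\<close>, which is an arbitrary choice of
  a weak gradient, independent of that choice up to null sets.\<close>

lemma weak_grad_unique:
  fixes u :: "real^'d \<Rightarrow> real"
  assumes "open \<Omega>" and G: "has_weak_grad \<Omega> u G" and G': "has_weak_grad \<Omega> u G'"
  shows "AE x in lebesgue_on \<Omega>. G x = G' x"
proof -
  have \<Omega>: "\<Omega> \<in> sets lebesgue" using \<open>open \<Omega>\<close> by (simp add: borel_open)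
  have "AE x in lebesgue_on \<Omega>. G x $ i - G' x $ i = 0" for i
  proof (rule AE_0_if_orthogonal_to_test_functions[OF \<open>open \<Omega>\<close>])
    show "locally_integrable \<Omega> (\<lambda>x. G x $ i - G' x $ i)"
      using G G' by (auto simp: has_weak_grad_def locally_integrable_def)
    fix \<phi> assume \<phi>: "\<phi> \<in> test_functions \<Omega>"
    from test_function_support[OF \<phi>] obtain K where K: "compact K" "K \<subseteq> \<Omega>" "\<And>x. x \<notin> K \<Longrightarrow> \<phi> x = 0"
      "continuous_on UNIV \<phi>" by (metis Ck.simps(1))
    have "integrable (lebesgue_on \<Omega>) (\<lambda>x. H x $ i * \<phi> x)" if "has_weak_grad \<Omega> u H" for H
    proof (rule integrable_mult_compact_support[OF _ \<Omega> K(4,1,2)])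
      show "locally_integrable \<Omega> (\<lambda>x. H x $ i)" using that by (simp add: has_weak_grad_def)
    qed (rule K(3))
    then have "integrable (lebesgue_on \<Omega>) (\<lambda>x. G x $ i * \<phi> x)" "integrable (lebesgue_on \<Omega>) (\<lambda>x. G' x $ i * \<phi> x)"
      using G G' by blast+
    moreover have "(LINT x|lebesgue_on \<Omega>. G x $ i * \<phi> x) = (LINT x|lebesgue_on \<Omega>. G' x $ i * \<phi> x)"
    proof -
      have "- (LINT x|lebesgue_on \<Omega>. G x $ i * \<phi> x) = - (LINT x|lebesgue_on \<Omega>. G' x $ i * \<phi> x)"
        using G G' \<phi> unfolding has_weak_grad_def by (elim conjE) (drule (1) bspec, drule (1) bspec, metis)
      then show ?thesis by simp
    qed
    ultimately show "(LINT x|lebesgue_on \<Omega>. (G x $ i - G' x $ i) * \<phi> x) = 0"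
      by (simp add: left_diff_distrib)
  qed
  then have "AE x in lebesgue_on \<Omega>. \<forall>i. G x $ i - G' x $ i = 0"
    by (subst AE_all_countable) auto
  then show ?thesis by eventually_elim (simp add: vec_eq_iff)
qed

section \<open>Continuously differentiable functions belong to \<open>H\<^sup>1\<close>\<close>

text \<open>Lebesgue measure is translation invariant, so the difference quotients of
  \<open>f\<close> in direction \<open>i\<close> all have integral zero. The mean value
  theorem bounds them uniformly by the supremum of the partial derivative's absolute value, and
  dominated convergence passes to the limit.\<close>

lemma integral_partial_compact_support:
  fixes f :: "real^'d \<Rightarrow> real"
  assumes f: "Ck (Suc 0) f" and K: "compact K" "\<And>x. x \<notin> K \<Longrightarrow> f x = 0"
    and K': "\<And>x. x \<notin> K \<Longrightarrow> partial i f x = 0"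
  shows "(LINT x|lborel. partial i f x) = 0"
proof -
  define e :: "real^'d" where "e = axis i 1"
  define h where "h n = inverse (real (Suc n))" for n
  have e: "norm e = 1" by (simp add: e_def norm_axis_1)
  have h: "0 < h n" "h n \<le> 1" for n by (auto simp: h_def inverse_eq_divide)
  have cf: "continuous_on UNIV f" using f by (rule Ck_imp_continuous)
  have cp: "continuous_on UNIV (partial i f)" using f by simp
  note [measurable] = borel_measurable_continuous_onI[OF cf] borel_measurable_continuous_onI[OF cp]
  obtain C where C: "\<bar>partial i f x\<bar> \<le> C" for x
  proof -
    have "bounded (partial i f ` K)"
      using K(1) cp by (intro compact_imp_bounded compact_continuous_image) (auto intro: continuous_on_subset)
    then obtain C where "\<And>x. x \<in> K \<Longrightarrow> \<bar>partial i f x\<bar> \<le> C" by (auto simp: bounded_iff)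
    then have "\<bar>partial i f x\<bar> \<le> \<bar>C\<bar>" for x using K'[of x] by (cases "x \<in> K") force+
    then show ?thesis using that by blast
  qed
  \<comment> \<open>The steps \<open>h n\<close> are at most \<open>1\<close>, so all difference
      quotients vanish outside the ball of radius \<open>R + 1\<close>.\<close>
  obtain R where R: "K \<subseteq> cball 0 R" 
    using compact_imp_bounded[OF K(1)] by (auto simp: bounded_iff subset_iff)
  have line: "((\<lambda>t. f (x + t *\<^sub>R e)) has_real_derivative partial i f (x + t *\<^sub>R e)) (at t)" for x t
  proof -
    have "((\<lambda>t. x + t *\<^sub>R e) has_derivative (\<lambda>t. t *\<^sub>R e)) (at t)"
      by (auto intro!: derivative_eq_intros)
    from has_derivative_compose[OF this Ck_Suc_derivative[OF f]]
    have "((\<lambda>t. f (x + t *\<^sub>R e)) has_derivative (\<lambda>s. frechet_derivative f (at (x + t *\<^sub>R e)) (s *\<^sub>R e))) (at t)" .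
    moreover have "frechet_derivative f (at (x + t *\<^sub>R e)) (s *\<^sub>R e) = s * partial i f (x + t *\<^sub>R e)" for s
      using linear_scale[OF has_derivative_linear[OF Ck_Suc_derivative[OF f]]]
      by (simp add: partial_def e_def)
    ultimately show ?thesis
      by (simp add: has_field_derivative_def mult.commute[of _ "partial i f (x + t *\<^sub>R e)"])
  qed
  define s where "s n x = (f (x + h n *\<^sub>R e) - f x) / h n" for n x
  have fi: "integrable lborel f"
  proof -
    have "indicator K x *\<^sub>R f x = f x" for x using K(2)[of x] by (cases "x \<in> K") auto
    then show ?thesis
      using borel_integrable_compact[OF K(1) continuous_on_subset[OF cf subset_UNIV]] by (simp only:)
  qed
  have shift: "integrable lborel (\<lambda>x. f (x + v))" "(LINT x|lborel. f (x + v)) = (LINT x|lborel. f x)" for v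
  proof -
    have d: "distr lborel borel ((+) v) = lborel" by (rule lborel_distr_plus)
    have "integrable (distr lborel borel ((+) v)) f" using fi by (simp add: d)
    then show "integrable lborel (\<lambda>x. f (x + v))"
      by (subst (asm) integrable_distr_eq) (auto simp: add.commute)
    have "(LINT x|distr lborel borel ((+) v). f x) = (LINT x|lborel. f (v + x))"
      by (rule integral_distr) auto
    then show "(LINT x|lborel. f (x + v)) = (LINT x|lborel. f x)"
      by (simp add: d add.commute)
  qed
  have "(LINT x|lborel. s n x) = 0" for n
    unfolding s_def using shift fi by simp
  moreover have "(\<lambda>n. LINT x|lborel. s n x) \<longlonglongrightarrow> (LINT x|lborel. partial i f x)"
  proof (rule integral_dominated_convergence[where w="\<lambda>x. C * indicator (cball 0 (R + 1)) x"])
    show "integrable lborel (\<lambda>x::real^'d. C * indicator (cball 0 (R + 1)) x)"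
      using emeasure_bounded_finite[OF bounded_cball[of "0::real^'d" "R + 1"]]
      by (intro integrable_mult_right integrable_real_indicator) auto
    show "AE x in lborel. (\<lambda>n. s n x) \<longlonglongrightarrow> partial i f x"
    proof (rule AE_I2)
      fix x
      have "((\<lambda>t. (f (x + t *\<^sub>R e) - f x) / t) \<longlongrightarrow> partial i f x) (at 0)"
        using line[of x 0] by (simp add: DERIV_def)
      moreover have "filterlim h (at 0) sequentially"
        using LIMSEQ_inverse_real_of_nat h(1) unfolding h_def[abs_def] filterlim_at
        by (auto simp: eventually_sequentially)
      ultimately show "(\<lambda>n. s n x) \<longlonglongrightarrow> partial i f x"
        unfolding s_def by (rule filterlim_compose)
    qed
    show "AE x in lborel. norm (s n x) \<le> C * indicator (cball 0 (R + 1)) x" for n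
    proof (rule AE_I2)
      fix x
      show "norm (s n x) \<le> C * indicator (cball 0 (R + 1)) x"
      proof (cases "x \<in> cball 0 (R + 1)")
        case True
        obtain z where "f (x + h n *\<^sub>R e) - f (x + 0 *\<^sub>R e) = (h n - 0) * partial i f (x + z *\<^sub>R e)"
          using MVT2[OF h(1) line] by blast
        then have "s n x = partial i f (x + z *\<^sub>R e)" using h(1)[of n] by (simp add: s_def)
        then show ?thesis using C True by simp
      next
        case False
        have "norm x \<le> norm (x + h n *\<^sub>R e) + norm (h n *\<^sub>R e)"
          using norm_triangle_ineq4[of "x + h n *\<^sub>R e" "h n *\<^sub>R e"] by simp
        also have "norm (h n *\<^sub>R e) \<le> 1" using h[of n] e by simp
        finally have "R < norm (x + h n *\<^sub>R e)" using False by simp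
        then have "f (x + h n *\<^sub>R e) = 0" "f x = 0"
          using False R by (auto intro!: K(2) dest: subsetD)
        then show ?thesis using False by (simp add: s_def)
      qed
    qed
    show "s n \<in> borel_measurable lborel" for n unfolding s_def by measurable
  qed simp
  ultimately show ?thesis using LIMSEQ_unique by (auto simp: LIMSEQ_const_iff)
qed

lemma continuous_integrable_on_bounded:
  fixes f :: "'a::euclidean_space \<Rightarrow> real"
  assumes f: "continuous_on UNIV f" and S: "bounded S" "S \<in> sets lebesgue"
  shows "integrable (lebesgue_on S) f"
proof -
  have "S \<in> lmeasurable" using S by (rule bounded_set_imp_lmeasurable)
  then interpret finite_measure "lebesgue_on S" by (rule finite_measure_lebesgue_on)
  have "bounded (f ` closure S)"
    using S f by (intro compact_imp_bounded compact_continuous_image)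
      (auto intro: continuous_on_subset simp: compact_closure)
  then obtain C where "\<And>x. x \<in> closure S \<Longrightarrow> \<bar>f x\<bar> \<le> C" by (auto simp: bounded_iff)
  then have "AE x in lebesgue_on S. norm (f x) \<le> C"
    using closure_subset[of S] by (intro AE_I2) auto
  then show ?thesis
    by (rule integrable_const_bound)
      (auto intro: continuous_imp_measurable_on_sets_lebesgue continuous_on_subset[OF f] S)
qed

lemma continuous_in_L2_on_bounded:
  fixes f :: "'a::euclidean_space \<Rightarrow> real"
  assumes f: "continuous_on UNIV f" and S: "bounded S" "S \<in> sets lebesgue"
  shows "f \<in> L2 (lebesgue_on S)"
  using continuous_integrable_on_bounded[OF continuous_on_power[OF f, of 2] S] S
  by (auto simp: L2_def intro: continuous_imp_measurable_on_sets_lebesgue continuous_on_subset[OF f])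

lemma continuous_locally_integrable: "continuous_on UNIV f \<Longrightarrow> locally_integrable \<Omega> f"
  unfolding locally_integrable_def
  by (auto intro!: continuous_integrable_on_bounded compact_imp_bounded simp: borel_compact)

text \<open>Integration by parts: the product of \<open>u\<close> with a test function is a
  compactly supported \<open>C\<^sup>1\<close> function, so the integral of its partial derivative
  is zero, and the product rule splits this integral into the two sides of the defining
  identity.\<close>

lemma C1_has_weak_grad:
  assumes "open \<Omega>" and u: "Ck (Suc 0) u"
  shows "has_weak_grad \<Omega> u (grad u)"
  unfolding has_weak_grad_def
proof (intro conjI ballI allI)
  have \<Omega>: "\<Omega> \<in> sets lebesgue" using \<open>open \<Omega>\<close> by (simp add: borel_open)
  have cu: "continuous_on UNIV u" and cgu: "continuous_on UNIV (\<lambda>x. grad u x $ i)" for i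
    using u Ck_imp_continuous[OF u] by (simp_all add: grad_def)
  show li: "locally_integrable \<Omega> u" and lgi: "locally_integrable \<Omega> (\<lambda>x. grad u x $ i)" for i
    using cu cgu by (auto intro: continuous_locally_integrable)
  fix \<phi> i assume "\<phi> \<in> test_functions \<Omega>"
  from test_function_support[OF this] obtain K where K: "compact K" "K \<subseteq> \<Omega>"
      "\<And>x. x \<notin> K \<Longrightarrow> \<phi> x = 0" "\<And>x i. x \<notin> K \<Longrightarrow> partial i \<phi> x = 0" "Ck (Suc 0) \<phi>"
    by metis
  have c\<phi>: "continuous_on UNIV \<phi>" "continuous_on UNIV (partial i \<phi>)"
    using K(5) Ck_imp_continuous[OF K(5)] by simp_all
  have int1: "integrable (lebesgue_on \<Omega>) (\<lambda>x. u x * partial i \<phi> x)"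
    by (rule integrable_mult_compact_support[OF li \<Omega> c\<phi>(2) K(1,2,4)])
  have int2: "integrable (lebesgue_on \<Omega>) (\<lambda>x. grad u x $ i * \<phi> x)"
    by (rule integrable_mult_compact_support[OF lgi \<Omega> c\<phi>(1) K(1,2,3)])
  have "((\<lambda>x. u x * \<phi> x) has_derivative
        (\<lambda>v. u x * frechet_derivative \<phi> (at x) v + frechet_derivative u (at x) v * \<phi> x)) (at x)" for x
    by (intro has_derivative_mult Ck_Suc_derivative[OF u] Ck_Suc_derivative[OF K(5)])
  from partial_eq_derivative_axis[OF this]
  have p: "partial i (\<lambda>x. u x * \<phi> x) x = u x * partial i \<phi> x + grad u x $ i * \<phi> x" for x
    by (simp add: partial_def grad_def)
  have "(LINT x|lebesgue_on \<Omega>. u x * partial i \<phi> x + grad u x $ i * \<phi> x) =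
      (LINT x|lebesgue. partial i (\<lambda>x. u x * \<phi> x) x)"
    unfolding integral_lebesgue_on(1)[OF \<Omega>]
  proof (rule Bochner_Integration.integral_cong[OF refl])
    fix x
    show "indicator \<Omega> x * (u x * partial i \<phi> x + grad u x $ i * \<phi> x) = partial i (\<lambda>x. u x * \<phi> x) x"
      unfolding p using subsetD[OF K(2), of x] K(3)[of x] K(4)[of x i] by (cases "x \<in> \<Omega>"; cases "x \<in> K") auto
  qed
  also have "\<dots> = (LINT x|lborel. partial i (\<lambda>x. u x * \<phi> x) x)"
  proof (rule integral_completion)
    have "continuous_on UNIV (partial i (\<lambda>x. u x * \<phi> x))"
      using Ck_mult[OF u K(5)] by simp
    then show "partial i (\<lambda>x. u x * \<phi> x) \<in> borel_measurable lborel"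
      by (simp add: borel_measurable_continuous_onI)
  qed
  also have "\<dots> = 0"
    using p K(3,4) by (intro integral_partial_compact_support[OF Ck_mult[OF u K(5)] K(1)]) auto
  finally show "(LINT x|lebesgue_on \<Omega>. u x * partial i \<phi> x) = - (LINT x|lebesgue_on \<Omega>. grad u x $ i * \<phi> x)"
    using int1 int2 by simp
qed

lemma C1_in_H1:
  assumes "open \<Omega>" "bounded \<Omega>" and u: "Ck (Suc 0) u"
  shows "u \<in> H1 \<Omega>"
proof -
  have \<Omega>: "\<Omega> \<in> sets lebesgue" using \<open>open \<Omega>\<close> by (simp add: borel_open)
  have "continuous_on UNIV u" "\<And>i. continuous_on UNIV (\<lambda>x. grad u x $ i)"
    using u Ck_imp_continuous[OF u] by (simp_all add: grad_def)
  then show ?thesis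
    unfolding H1_def using C1_has_weak_grad[OF assms(1) u]
    by (auto intro!: exI[of _ "grad u"] continuous_in_L2_on_bounded[OF _ assms(2) \<Omega>])
qed

section \<open>Regularity of networks\<close>

lemma C1_affine_layer:
  assumes "\<And>j. Ck (Suc 0) (\<lambda>x. y x j)"
  shows "Ck (Suc 0) (\<lambda>x. affine_layer N \<theta> l (y x) i)"
  unfolding affine_layer_def by (intro Ck_add Ck_sum Ck_mult Ck_const assms)

lemma C1_hidden_layer: "Ck (Suc 0) (\<lambda>x. hidden_layer N \<theta> l x j)"
proof (induction l arbitrary: j)
  case 0
  show ?case unfolding hidden_layer.simps by (rule Ck_coordinate)
next
  case (Suc l)
  show ?case unfolding hidden_layer.simps by (intro C1_tanh C1_affine_layer Suc)
qed

text \<open>The hyperbolic tangent is differentiable with continuous derivative, so networks are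
  \<open>C\<^sup>1\<close> on the whole space.\<close>

lemma C1_PNN:
  assumes "u \<in> PNN m M W L B" shows "Ck (Suc 0) u"
proof -
  from assms obtain c \<phi> where u: "u = (\<lambda>x. \<Sum>k<m. c k * \<phi> k x)"
    and \<phi>: "\<forall>k<m. \<exists>W' L' B'. \<phi> k \<in> NN W' L' B'"
    unfolding PNN_def by blast
  have "Ck (Suc 0) (\<phi> k)" if "k < m" for k
  proof -
    from \<phi> that obtain W' L' B' where "\<phi> k \<in> NN W' L' B'" by blast
    then obtain N \<theta> where "\<phi> k = network L' N \<theta>" unfolding NN_def by blast
    then show ?thesis
      unfolding network_def by (simp only:) (intro C1_affine_layer C1_hidden_layer)
  qed
  then show ?thesis unfolding u by (intro Ck_sum Ck_mult Ck_const) auto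
qed

section \<open>Differences in \<open>H\<^sup>1\<close>\<close>

lemma L2_mult_integrable:
  assumes "f \<in> L2 M" "g \<in> L2 M"
  shows "integrable M (\<lambda>x. f x * g x)"
proof (rule Bochner_Integration.integrable_bound)
  show "integrable M (\<lambda>x. (f x)\<^sup>2 + (g x)\<^sup>2)" using assms by (auto simp: L2_def)
  show "(\<lambda>x. f x * g x) \<in> borel_measurable M" using assms by (auto simp: L2_def)
  show "AE x in M. norm (f x * g x) \<le> norm ((f x)\<^sup>2 + (g x)\<^sup>2)"
  proof (rule AE_I2)
    fix x
    have "2 * (\<bar>f x\<bar> * \<bar>g x\<bar>) \<le> (f x)\<^sup>2 + (g x)\<^sup>2"
      using sum_squares_bound[of "\<bar>f x\<bar>" "\<bar>g x\<bar>"] by simp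
    moreover have "0 \<le> \<bar>f x\<bar> * \<bar>g x\<bar>" by simp
    ultimately show "norm (f x * g x) \<le> norm ((f x)\<^sup>2 + (g x)\<^sup>2)" 
      unfolding real_norm_def abs_mult by linarith
  qed
qed

lemma L2_diff:
  assumes "f \<in> L2 M" "g \<in> L2 M"
  shows "(\<lambda>x. f x - g x) \<in> L2 M"
proof -
  have "integrable M (\<lambda>x. (f x)\<^sup>2 + (g x)\<^sup>2 - 2 * (f x * g x))"
    using assms L2_mult_integrable[OF assms] by (auto simp: L2_def)
  then show ?thesis
    using assms by (auto simp: L2_def power2_diff mult.assoc)
qed

lemma L2_mult_bounded_integrable:
  assumes f: "f \<in> L2 M" and g: "g \<in> L2 M" and w: "w \<in> borel_measurable M"
    and C: "\<And>x. x \<in> space M \<Longrightarrow> \<bar>w x\<bar> \<le> C"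
  shows "integrable M (\<lambda>x. w x * (f x * g x))"
proof (rule Bochner_Integration.integrable_bound)
  show "integrable M (\<lambda>x. C * (f x * g x))" using L2_mult_integrable[OF f g] by simp
  show "(\<lambda>x. w x * (f x * g x)) \<in> borel_measurable M" using assms by (auto simp: L2_def)
  show "AE x in M. norm (w x * (f x * g x)) \<le> norm (C * (f x * g x))"
  proof (rule AE_I2)
    fix x assume "x \<in> space M"
    then have "\<bar>w x\<bar> \<le> \<bar>C\<bar>" using C[of x] by linarith
    then show "norm (w x * (f x * g x)) \<le> norm (C * (f x * g x))"
      by (simp add: abs_mult mult_right_mono)
  qed
qed

text \<open>Lebesgue measure is complete, hence changing a function on a null set preserves
  measurability.\<close>

lemma L2_cong_AE_lebesgue_on:
  fixes f g :: "'a::euclidean_space \<Rightarrow> real"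
  assumes S: "S \<in> sets lebesgue" and f: "f \<in> L2 (lebesgue_on S)"
    and ae: "AE x in lebesgue_on S. f x = g x"
  shows "g \<in> L2 (lebesgue_on S)"
proof -
  have fm: "f \<in> borel_measurable (lebesgue_on S)" using f by (simp add: L2_def)
  then have "(\<lambda>x. indicator S x *\<^sub>R f x) \<in> borel_measurable lebesgue"
    using S by (simp add: borel_measurable_restrict_space_iff)
  moreover have "AE x in lebesgue. x \<in> S \<longrightarrow> f x = g x" using ae S by (simp add: AE_restrict_space_iff)
  then have "AE x in lebesgue. indicator S x *\<^sub>R f x = indicator S x *\<^sub>R g x"
    by eventually_elim (auto simp: indicator_def)
  ultimately have "(\<lambda>x. indicator S x *\<^sub>R g x) \<in> borel_measurable lebesgue"
    by (rule borel_measurable_AE)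
  then have gm: "g \<in> borel_measurable (lebesgue_on S)"
    using S by (simp add: borel_measurable_restrict_space_iff)
  have "integrable (lebesgue_on S) (\<lambda>x. (g x)\<^sup>2)"
  proof (rule integrable_cong_AE_imp)
    show "integrable (lebesgue_on S) (\<lambda>x. (f x)\<^sup>2)" using f by (simp add: L2_def)
    show "(\<lambda>x. (g x)\<^sup>2) \<in> borel_measurable (lebesgue_on S)" using gm by measurable
    show "AE x in lebesgue_on S. (f x)\<^sup>2 = (g x)\<^sup>2" using ae by eventually_elim simp
  qed
  then show ?thesis using gm by (simp add: L2_def)
qed

text \<open>Membership in \<open>H1\<close> only provides some square integrable weak gradient; by
  uniqueness the chosen one agrees with it almost everywhere.\<close>

lemma H1_weak_grad:
  assumes "open \<Omega>" "u \<in> H1 \<Omega>"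
  shows "has_weak_grad \<Omega> u (weak_grad \<Omega> u)" "(\<lambda>x. weak_grad \<Omega> u x $ i) \<in> L2 (lebesgue_on \<Omega>)"
proof -
  obtain G where G: "has_weak_grad \<Omega> u G" "\<And>i. (\<lambda>x. G x $ i) \<in> L2 (lebesgue_on \<Omega>)"
    using assms(2) unfolding H1_def by blast
  show wg: "has_weak_grad \<Omega> u (weak_grad \<Omega> u)"
    unfolding weak_grad_def using G(1) by (rule someI[of "has_weak_grad \<Omega> u"])
  have "AE x in lebesgue_on \<Omega>. G x = weak_grad \<Omega> u x"
    by (rule weak_grad_unique[OF assms(1) G(1) wg])
  then have "AE x in lebesgue_on \<Omega>. G x $ i = weak_grad \<Omega> u x $ i"
    by eventually_elim simp
  with _ G(2) show "(\<lambda>x. weak_grad \<Omega> u x $ i) \<in> L2 (lebesgue_on \<Omega>)"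
    by (rule L2_cong_AE_lebesgue_on) (simp add: borel_open assms(1))
qed

lemma has_weak_grad_diff:
  assumes "open \<Omega>" and G: "has_weak_grad \<Omega> u G" and H: "has_weak_grad \<Omega> v H"
  shows "has_weak_grad \<Omega> (\<lambda>x. u x - v x) (\<lambda>x. G x - H x)"
  unfolding has_weak_grad_def
proof (intro conjI ballI allI)
  have \<Omega>: "\<Omega> \<in> sets lebesgue" using \<open>open \<Omega>\<close> by (simp add: borel_open)
  show "locally_integrable \<Omega> (\<lambda>x. u x - v x)" "locally_integrable \<Omega> (\<lambda>x. (G x - H x) $ i)" for i
    using G H by (auto simp: has_weak_grad_def locally_integrable_def)
  fix \<phi> i assume \<phi>: "\<phi> \<in> test_functions \<Omega>"
  from test_function_support[OF this] obtain K where K: "compact K" "K \<subseteq> \<Omega>"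
      "\<And>x. x \<notin> K \<Longrightarrow> \<phi> x = 0" "\<And>x i. x \<notin> K \<Longrightarrow> partial i \<phi> x = 0" "Ck (Suc 0) \<phi>"
    by metis
  have c\<phi>: "continuous_on UNIV \<phi>" "continuous_on UNIV (partial i \<phi>)"
    using K(5) Ck_imp_continuous[OF K(5)] by simp_all
  have int: "integrable (lebesgue_on \<Omega>) (\<lambda>x. w x * partial i \<phi> x)"
    "integrable (lebesgue_on \<Omega>) (\<lambda>x. F x $ i * \<phi> x)" if w: "has_weak_grad \<Omega> w F" for w F
  proof -
    have l: "locally_integrable \<Omega> w" "locally_integrable \<Omega> (\<lambda>x. F x $ i)"
      using w by (auto simp: has_weak_grad_def)
    show "integrable (lebesgue_on \<Omega>) (\<lambda>x. w x * partial i \<phi> x)"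
      by (rule integrable_mult_compact_support[OF l(1) \<Omega> c\<phi>(2) K(1,2,4)])
    show "integrable (lebesgue_on \<Omega>) (\<lambda>x. F x $ i * \<phi> x)"
      by (rule integrable_mult_compact_support[OF l(2) \<Omega> c\<phi>(1) K(1,2,3)])
  qed
  have "(LINT x|lebesgue_on \<Omega>. u x * partial i \<phi> x) = - (LINT x|lebesgue_on \<Omega>. G x $ i * \<phi> x)"
    "(LINT x|lebesgue_on \<Omega>. v x * partial i \<phi> x) = - (LINT x|lebesgue_on \<Omega>. H x $ i * \<phi> x)"
    using G H \<phi> by (simp_all add: has_weak_grad_def)
  then show "(LINT x|lebesgue_on \<Omega>. (u x - v x) * partial i \<phi> x) =
      - (LINT x|lebesgue_on \<Omega>. (G x - H x) $ i * \<phi> x)"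
    using int[OF G] int[OF H] by (simp add: left_diff_distrib)
qed

lemma H1_diff:
  assumes "open \<Omega>" "u \<in> H1 \<Omega>" "v \<in> H1 \<Omega>"
  shows "(\<lambda>x. u x - v x) \<in> H1 \<Omega>"
    and "AE x in lebesgue_on \<Omega>. weak_grad \<Omega> (\<lambda>x. u x - v x) x = weak_grad \<Omega> u x - weak_grad \<Omega> v x"
proof -
  note G = H1_weak_grad[OF assms(1,2)] and H = H1_weak_grad[OF assms(1,3)]
  have wg: "has_weak_grad \<Omega> (\<lambda>x. u x - v x) (\<lambda>x. weak_grad \<Omega> u x - weak_grad \<Omega> v x)"
    by (rule has_weak_grad_diff[OF assms(1) G(1) H(1)])
  moreover have "(\<lambda>x. (weak_grad \<Omega> u x - weak_grad \<Omega> v x) $ i) \<in> L2 (lebesgue_on \<Omega>)" for i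
    using L2_diff[OF G(2) H(2)] by simp
  moreover have "(\<lambda>x. u x - v x) \<in> L2 (lebesgue_on \<Omega>)"
    using assms by (auto simp: H1_def intro: L2_diff)
  ultimately show w: "(\<lambda>x. u x - v x) \<in> H1 \<Omega>" unfolding H1_def by blast
  show "AE x in lebesgue_on \<Omega>. weak_grad \<Omega> (\<lambda>x. u x - v x) x = weak_grad \<Omega> u x - weak_grad \<Omega> v x"
    by (rule weak_grad_unique[OF assms(1) H1_weak_grad(1)[OF assms(1) w] wg])
qed

lemma weak_grad_inner_integrable:
  assumes "open \<Omega>" "u \<in> H1 \<Omega>" "v \<in> H1 \<Omega>"
  shows "integrable (lebesgue_on \<Omega>) (\<lambda>x. weak_grad \<Omega> u x \<bullet> weak_grad \<Omega> v x)"
  unfolding inner_vec_def inner_real_def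
  by (intro Bochner_Integration.integrable_sum L2_mult_integrable H1_weak_grad assms)

section \<open>Excess Ritz loss\<close>

text \<open>The Ritz loss is a quadratic functional, and the weak formulation, tested with
  \<open>w = u - u0\<close>, says that its linear part around \<open>u0\<close> vanishes. What is
  left of the difference of the losses is the quadratic part in \<open>w\<close>. Linearity of the
  trace is what matches the boundary terms.\<close>

lemma ritz_loss_excess_eq_energy:
  fixes \<Omega> :: "(real^'d) set" and u u0 w :: "real^'d \<Rightarrow> real"
  assumes "open \<Omega>" and h: "h \<in> L2 (lebesgue_on \<Omega>)" and g: "g \<in> L2 (surface_measure \<Omega>)"
    and \<omega>: "\<omega> \<in> borel_measurable (lebesgue_on \<Omega>)" "\<forall>x\<in>\<Omega>. \<bar>\<omega> x\<bar> \<le> C"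
    and Tr: "is_trace_operator \<Omega> Tr" and sol: "neumann_weak_solution \<Omega> Tr \<omega> h g u0"
    and u: "u \<in> H1 \<Omega>"
    and w_def: "w = (\<lambda>x. u x - u0 x)"
  shows "integrable (lebesgue_on \<Omega>) (\<lambda>x. (w x)\<^sup>2)"
    and "integrable (lebesgue_on \<Omega>) (\<lambda>x. (norm (weak_grad \<Omega> w x))\<^sup>2)"
    and "integrable (lebesgue_on \<Omega>) (\<lambda>x. \<omega> x * (w x)\<^sup>2)"
    and "ritz_loss \<Omega> Tr \<omega> h g u - ritz_loss \<Omega> Tr \<omega> h g u0 =
      1/2 * (LINT x|lebesgue_on \<Omega>. (norm (weak_grad \<Omega> w x))\<^sup>2 + \<omega> x * (w x)\<^sup>2)"
proof -
  let ?M = "lebesgue_on \<Omega>" and ?S = "surface_measure \<Omega>"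
  have u0: "u0 \<in> H1 \<Omega>" using sol by (simp add: neumann_weak_solution_def)
  have w: "w \<in> H1 \<Omega>" unfolding w_def by (rule H1_diff[OF assms(1) u u0])
  have L2: "u \<in> L2 ?M" "u0 \<in> L2 ?M" "w \<in> L2 ?M" using u u0 w by (auto simp: H1_def)
  have grad: "integrable ?M (\<lambda>x. (norm (weak_grad \<Omega> v x))\<^sup>2)" if "v \<in> H1 \<Omega>" for v
    using weak_grad_inner_integrable[OF assms(1) that that] by (simp add: power2_norm_eq_inner)
  have om: "integrable ?M (\<lambda>x. \<omega> x * (p x * q x))" if "p \<in> L2 ?M" "q \<in> L2 ?M" for p q
    using \<omega>(2) by (intro L2_mult_bounded_integrable[OF that \<omega>(1), of C]) simp
  show int_w: "integrable ?M (\<lambda>x. (w x)\<^sup>2)" using L2 by (simp add: L2_def)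
  show int_Gw: "integrable ?M (\<lambda>x. (norm (weak_grad \<Omega> w x))\<^sup>2)" by (rule grad[OF w])
  show int_ow: "integrable ?M (\<lambda>x. \<omega> x * (w x)\<^sup>2)" using om[OF L2(3,3)] by (simp add: power2_eq_square)
  define E where "E v x = 1/2 * (norm (weak_grad \<Omega> v x))\<^sup>2 + 1/2 * \<omega> x * (v x)\<^sup>2 - h x * v x" for v x
  have int_E: "integrable ?M (E v)" if "v \<in> H1 \<Omega>" for v
  proof -
    have v: "v \<in> L2 ?M" using that by (simp add: H1_def)
    have "integrable ?M (\<lambda>x. 1/2 * (norm (weak_grad \<Omega> v x))\<^sup>2 + 1/2 * (\<omega> x * (v x * v x)) - h x * v x)"
      using grad[OF that] om[OF v v] L2_mult_integrable[OF h v] by auto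
    then show ?thesis unfolding E_def by (simp add: power2_eq_square mult.assoc)
  qed
  define Q where "Q x = (norm (weak_grad \<Omega> w x))\<^sup>2 + \<omega> x * (w x)\<^sup>2" for x
  \<comment> \<open>\<open>Q\<close> is the quadratic part in \<open>w\<close>, and
      \<open>P\<close> the integrand of the bilinear form at \<open>u0\<close> and
      \<open>w\<close>.\<close>
  define P where "P x = weak_grad \<Omega> u0 x \<bullet> weak_grad \<Omega> w x + \<omega> x * u0 x * w x" for x
  have int_Q: "integrable ?M Q" unfolding Q_def using int_Gw int_ow by simp
  have int_P: "integrable ?M P"
    unfolding P_def using weak_grad_inner_integrable[OF assms(1) u0 w] om[OF L2(2,3)]
    by (simp add: mult.assoc)
  have int_hw: "integrable ?M (\<lambda>x. h x * w x)" by (rule L2_mult_integrable[OF h L2(3)])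
  have "AE x in ?M. E u x - E u0 x = 1/2 * Q x + P x - h x * w x"
    using H1_diff(2)[OF assms(1) u u0]
  proof eventually_elim
    case (elim x)
    then have G: "weak_grad \<Omega> u x = weak_grad \<Omega> u0 x + weak_grad \<Omega> w x" by (simp add: w_def)
    have "(norm (weak_grad \<Omega> u x))\<^sup>2 =
        (norm (weak_grad \<Omega> u0 x))\<^sup>2 + 2 * (weak_grad \<Omega> u0 x \<bullet> weak_grad \<Omega> w x) + (norm (weak_grad \<Omega> w x))\<^sup>2"
      unfolding G power2_norm_eq_inner by (simp add: inner_add inner_commute)
    moreover have "u x = u0 x + w x" by (simp add: w_def)
    ultimately show ?case
      by (simp add: E_def Q_def P_def) (simp add: field_simps power2_eq_square)
  qed
  then have "(LINT x|?M. E u x - E u0 x) = (LINT x|?M. 1/2 * Q x + P x - h x * w x)"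
    using int_E[OF u] int_E[OF u0] int_Q int_P int_hw
    by (intro integral_cong_AE) (auto intro!: borel_measurable_integrable)
  then have vol: "(LINT x|?M. E u x) - (LINT x|?M. E u0 x) =
      1/2 * (LINT x|?M. Q x) + (LINT x|?M. P x) - (LINT x|?M. h x * w x)"
    using int_E[OF u] int_E[OF u0] int_Q int_P int_hw by simp
  have eq: "(LINT x|?M. P x) = (LINT x|?M. h x * w x) + (LINT x|?S. g x * Tr w x)"
    using sol w unfolding neumann_weak_solution_def P_def by blast
  have bd: "(LINT x|?S. g x * Tr w x) = (LINT x|?S. g x * Tr u x) - (LINT x|?S. g x * Tr u0 x)"
  proof -
    have T: "Tr v \<in> L2 ?S" if "v \<in> H1 \<Omega>" for v using Tr that by (simp add: is_trace_operator_def)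
    have int_T: "integrable ?S (\<lambda>x. g x * Tr v x)" if "v \<in> H1 \<Omega>" for v
      by (rule L2_mult_integrable[OF g T[OF that]])
    have "AE x in ?S. Tr (\<lambda>x. 1 * u x + (- 1) * u0 x) x = 1 * Tr u x + (- 1) * Tr u0 x"
      using Tr u u0 unfolding is_trace_operator_def by blast
    then have "AE x in ?S. g x * Tr w x = g x * Tr u x - g x * Tr u0 x"
      unfolding w_def by eventually_elim (simp add: right_diff_distrib)
    then have "(LINT x|?S. g x * Tr w x) = (LINT x|?S. g x * Tr u x - g x * Tr u0 x)"
      using int_T[OF u] int_T[OF u0] int_T[OF w]
      by (intro integral_cong_AE) (auto intro!: borel_measurable_integrable)
    then show ?thesis using int_T[OF u] int_T[OF u0] by simp
  qed
  show "ritz_loss \<Omega> Tr \<omega> h g u - ritz_loss \<Omega> Tr \<omega> h g u0 =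
      1/2 * (LINT x|?M. (norm (weak_grad \<Omega> w x))\<^sup>2 + \<omega> x * (w x)\<^sup>2)"
    using vol eq bd unfolding ritz_loss_def E_def Q_def by linarith
qed

lemma H1_norm_power2:
  "(H1_norm \<Omega> u)\<^sup>2 = (LINT x|lebesgue_on \<Omega>. (u x)\<^sup>2) + (LINT x|lebesgue_on \<Omega>. (norm (weak_grad \<Omega> u x))\<^sup>2)"
  unfolding H1_norm_def by (subst real_sqrt_pow2) auto

text \<open>This gives measurability and boundedness of the coefficient, which make the weighted
  energy integrals finite.\<close>

lemma holder_on_compact_bounded:
  assumes "holder_on \<alpha> S f" "0 < \<alpha>" "compact S"
  shows "continuous_on S f" "\<exists>C. \<forall>x\<in>S. \<bar>f x\<bar> \<le> C"
proof -
  obtain C where C: "0 \<le> C" "\<And>x y. x \<in> S \<Longrightarrow> y \<in> S \<Longrightarrow> \<bar>f x - f y\<bar> \<le> C * dist x y powr \<alpha>"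
    using assms(1) unfolding holder_on_def by blast
  show cont: "continuous_on S f"
    unfolding continuous_on_def
  proof
    fix x assume x: "x \<in> S"
    have "((\<lambda>y. dist y x powr \<alpha>) \<longlongrightarrow> 0) (at x within S)"
      by (rule tendsto_eq_rhs[OF tendsto_powr'])
         (auto intro!: tendsto_eq_intros simp: assms(2))
    then have "((\<lambda>y. C * dist y x powr \<alpha>) \<longlongrightarrow> 0) (at x within S)"
      by (rule tendsto_mult_right_zero)
    then have "((\<lambda>y. f y - f x) \<longlongrightarrow> 0) (at x within S)"
      by (rule Lim_null_comparison[rotated]) (auto simp: eventually_at_filter intro!: C(2) x always_eventually)
    then show "(f \<longlongrightarrow> f x) (at x within S)" by (simp add: LIM_zero_iff)
  qed
  have "bounded (f ` S)" by (intro compact_imp_bounded compact_continuous_image cont assms)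
  then show "\<exists>C. \<forall>x\<in>S. \<bar>f x\<bar> \<le> C" by (auto simp: bounded_iff)
qed

lemma essential_bound_le_data_bound: "AE x in lebesgue_on \<Omega>. ereal \<bar>\<omega> x\<bar> \<le> data_bound \<Omega> \<omega> h g"
proof -
  have "Linf_norm (lebesgue_on \<Omega>) \<omega> \<le> data_bound \<Omega> \<omega> h g"
    unfolding data_bound_def by (intro Max_ge) auto
  moreover have "AE x in lebesgue_on \<Omega>. ereal \<bar>\<omega> x\<bar> \<le> Linf_norm (lebesgue_on \<Omega>) \<omega>"
    unfolding Linf_norm_def by (rule esssup_AE)
  ultimately show ?thesis by (auto elim: eventually_mono)
qed

lemma ritz_loss_excess_lower:
  fixes \<Omega> :: "(real^'d) set"
  assumes "open \<Omega>" and h: "h \<in> L2 (lebesgue_on \<Omega>)" and g: "g \<in> L2 (surface_measure \<Omega>)"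
    and \<omega>: "\<omega> \<in> borel_measurable (lebesgue_on \<Omega>)" "\<forall>x\<in>\<Omega>. \<bar>\<omega> x\<bar> \<le> C"
    and Tr: "is_trace_operator \<Omega> Tr" and sol: "neumann_weak_solution \<Omega> Tr \<omega> h g u0"
    and u: "u \<in> H1 \<Omega>" and c0: "\<forall>x\<in>\<Omega>. c0 \<le> \<omega> x"
  shows "min c0 1 / 2 * (H1_norm \<Omega> (\<lambda>x. u x - u0 x))\<^sup>2 \<le>
    ritz_loss \<Omega> Tr \<omega> h g u - ritz_loss \<Omega> Tr \<omega> h g u0"
proof -
  define w where "w = (\<lambda>x. u x - u0 x)"
  note E = ritz_loss_excess_eq_energy[OF assms(1-8) w_def]
  have "(LINT x|lebesgue_on \<Omega>. min c0 1 * ((w x)\<^sup>2 + (norm (weak_grad \<Omega> w x))\<^sup>2)) \<le>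
      (LINT x|lebesgue_on \<Omega>. (norm (weak_grad \<Omega> w x))\<^sup>2 + \<omega> x * (w x)\<^sup>2)"
  proof (rule integral_mono)
    fix x assume "x \<in> space (lebesgue_on \<Omega>)"
    then have "min c0 1 \<le> \<omega> x" using c0 by (simp add: min.coboundedI1)
    then have "min c0 1 * (w x)\<^sup>2 \<le> \<omega> x * (w x)\<^sup>2" by (intro mult_right_mono) auto
    moreover have "min c0 1 * (norm (weak_grad \<Omega> w x))\<^sup>2 \<le> 1 * (norm (weak_grad \<Omega> w x))\<^sup>2"
      by (intro mult_right_mono) auto
    ultimately show "min c0 1 * ((w x)\<^sup>2 + (norm (weak_grad \<Omega> w x))\<^sup>2) \<le>
        (norm (weak_grad \<Omega> w x))\<^sup>2 + \<omega> x * (w x)\<^sup>2"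
      by (simp add: distrib_left)
  qed (use E in auto)
  then show ?thesis
    unfolding w_def[symmetric] E(4) H1_norm_power2 using E(1,2) by simp
qed

lemma ritz_loss_excess_upper:
  fixes \<Omega> :: "(real^'d) set"
  assumes "open \<Omega>" and h: "h \<in> L2 (lebesgue_on \<Omega>)" and g: "g \<in> L2 (surface_measure \<Omega>)"
    and \<omega>: "\<omega> \<in> borel_measurable (lebesgue_on \<Omega>)" "\<forall>x\<in>\<Omega>. \<bar>\<omega> x\<bar> \<le> C"
    and Tr: "is_trace_operator \<Omega> Tr" and sol: "neumann_weak_solution \<Omega> Tr \<omega> h g u0"
    and u: "u \<in> H1 \<Omega>" and b: "AE x in lebesgue_on \<Omega>. \<bar>\<omega> x\<bar> \<le> b" "1 \<le> b"
  shows "ritz_loss \<Omega> Tr \<omega> h g u - ritz_loss \<Omega> Tr \<omega> h g u0 \<le>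
    b / 2 * (H1_norm \<Omega> (\<lambda>x. u x - u0 x))\<^sup>2"
proof -
  define w where "w = (\<lambda>x. u x - u0 x)"
  note E = ritz_loss_excess_eq_energy[OF assms(1-8) w_def]
  have "(LINT x|lebesgue_on \<Omega>. (norm (weak_grad \<Omega> w x))\<^sup>2 + \<omega> x * (w x)\<^sup>2) \<le>
      (LINT x|lebesgue_on \<Omega>. b * ((w x)\<^sup>2 + (norm (weak_grad \<Omega> w x))\<^sup>2))"
  proof (rule integral_mono_AE)
    show "AE x in lebesgue_on \<Omega>. (norm (weak_grad \<Omega> w x))\<^sup>2 + \<omega> x * (w x)\<^sup>2 \<le>
        b * ((w x)\<^sup>2 + (norm (weak_grad \<Omega> w x))\<^sup>2)"
      using b(1)
    proof eventually_elim
      case (elim x)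
      then have "\<omega> x * (w x)\<^sup>2 \<le> b * (w x)\<^sup>2" by (intro mult_right_mono) auto
      moreover have "1 * (norm (weak_grad \<Omega> w x))\<^sup>2 \<le> b * (norm (weak_grad \<Omega> w x))\<^sup>2"
        using b(2) by (intro mult_right_mono) auto
      ultimately show ?case by (simp add: distrib_left)
    qed
  qed (use E in auto)
  then show ?thesis
    unfolding w_def[symmetric] E(4) H1_norm_power2 using E(1,2) by simp
qed

section \<open>The error decomposition\<close>

text \<open>The statistical error enters at two functions of the class, each bounded by the
  supremum, which may be infinite.\<close>

lemma ereal_le_double_SUP:
  fixes f :: "'a \<Rightarrow> real"
  assumes "u \<in> F" "v \<in> F"
  shows "ereal (\<bar>f u\<bar> + \<bar>f v\<bar>) \<le> 2 * (SUP u\<in>F. ereal \<bar>f u\<bar>)"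
proof -
  have "ereal \<bar>f u\<bar> \<le> (SUP u\<in>F. ereal \<bar>f u\<bar>)" "ereal \<bar>f v\<bar> \<le> (SUP u\<in>F. ereal \<bar>f u\<bar>)"
    using assms by (auto intro: SUP_upper)
  then show ?thesis by (cases "SUP u\<in>F. ereal \<bar>f u\<bar>") auto
qed

theorem theorem3p1:
  fixes \<Omega> :: "(real^'d) set" and \<alpha> c0 :: real
    and h g \<omega> u0 ubar :: "real^'d \<Rightarrow> real"
    and Tr :: "(real^'d \<Rightarrow> real) \<Rightarrow> real^'d \<Rightarrow> real"
    and P :: "'w measure" and \<xi> :: 'w
    and N_in N_b :: nat and X Y :: "nat \<Rightarrow> 'w \<Rightarrow> real^'d"
    and m T :: nat and L :: "nat \<Rightarrow> nat" and N :: "nat \<Rightarrow> nat \<Rightarrow> nat"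
    and B lam \<eta> \<zeta> :: real and \<theta> :: "nat \<Rightarrow> 'w \<Rightarrow> pnn_index \<Rightarrow> real"
    and u_A :: "'w \<Rightarrow> real^'d \<Rightarrow> real"
    and Lhat :: "'w \<Rightarrow> (real^'d \<Rightarrow> real) \<Rightarrow> real"
    and m1 W1 D1 m2 W2 D2 :: nat and M1 B1 M2 B2 :: real
    and F F' :: "(real^'d \<Rightarrow> real) set"
  assumes domain: "open \<Omega>" "bounded \<Omega>" "\<Omega> \<noteq> {}" "\<Omega> \<subseteq> {x. \<forall>i. x $ i \<in> {0..1}}"
    and boundary: "0 < \<alpha>" "\<alpha> < 1" "C2_holder_boundary \<alpha> \<Omega>"
    and data: "h \<in> L2 (lebesgue_on \<Omega>)" "g \<in> H_half \<Omega>" "holder_on \<alpha> (closure \<Omega>) \<omega>"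
    and coercive: "0 < c0" "\<forall>x\<in>closure \<Omega>. c0 \<le> \<omega> x"
    and trace: "is_trace_operator \<Omega> Tr"
    and solution: "neumann_weak_solution \<Omega> Tr \<omega> h g u0" "u0 \<in> H2 \<Omega>"
    and samples: "prob_space P" "0 < N_in" "0 < N_b"
      "iid_uniform P lborel \<Omega> X {..<N_in}"
      "iid_uniform P (hausdorff_measure (CARD('d) - 1)) (frontier \<Omega>) Y {..<N_b}"
    and Lhat: "\<forall>\<xi>\<in>space P. Lhat \<xi> = empirical_loss \<Omega> \<omega> h g N_in N_b (\<lambda>p. X p \<xi>) (\<lambda>p. Y p \<xi>)"
    and architecture: "\<forall>k<m. nn_arch CARD('d) (L k) (N k)"
    and initialization: "0 < B"
      "iid_uniform P lborel {-B..B} (\<lambda>q \<xi>. \<theta> 0 \<xi> q) (inner_params m L N)"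
    and descent: "\<forall>\<xi>\<in>space P. pgd_run m L N (\<lambda>\<psi>. Lhat \<xi> (parallel_network m L N \<psi>))
      lam \<eta> \<zeta> T (\<lambda>t. \<theta> t \<xi>)"
    and u_A: "\<forall>\<xi>\<in>space P. u_A \<xi> = parallel_network m L N (\<theta> T \<xi>)"
    and classes: "F = PNN m1 M1 W1 D1 B1" "F' = PNN m2 M2 W2 D2 B2" "F' \<subseteq> F"
    and ubar: "is_arg_min (\<lambda>u. (H1_norm \<Omega> (\<lambda>x. u x - u0 x))\<^sup>2) (\<lambda>u. u \<in> F') ubar"
    and outcome: "\<xi> \<in> space P" "u_A \<xi> \<in> F"
  shows "ereal ((H1_norm \<Omega> (\<lambda>x. u_A \<xi> x - u0 x))\<^sup>2) \<le>
    ereal (2 / min c0 1) *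
      (max (data_bound \<Omega> \<omega> h g) 1 / 2 * ereal ((H1_norm \<Omega> (\<lambda>x. ubar x - u0 x))\<^sup>2) +
       ereal (Lhat \<xi> (u_A \<xi>) - Lhat \<xi> ubar) +
       2 * (SUP u\<in>F. ereal \<bar>ritz_loss \<Omega> Tr \<omega> h g u - Lhat \<xi> u\<bar>))"
proof -
  let ?L = "ritz_loss \<Omega> Tr \<omega> h g" and ?e = "\<lambda>u. (H1_norm \<Omega> (\<lambda>x. u x - u0 x))\<^sup>2"
  let ?S = "SUP u\<in>F. ereal \<bar>?L u - Lhat \<xi> u\<bar>" and ?D = "max (data_bound \<Omega> \<omega> h g) 1"
  have \<Omega>: "\<Omega> \<in> sets lebesgue" using domain(1) by (simp add: borel_open)
  have "compact (closure \<Omega>)" using domain(2) by (simp add: compact_closure)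
  note \<omega> = holder_on_compact_bounded[OF data(3) boundary(1) this]
  have \<omega>_meas: "\<omega> \<in> borel_measurable (lebesgue_on \<Omega>)"
    by (intro continuous_imp_measurable_on_sets_lebesgue \<Omega> continuous_on_subset[OF \<omega>(1)] closure_subset)
  obtain C where C: "\<forall>x\<in>\<Omega>. \<bar>\<omega> x\<bar> \<le> C" using \<omega>(2) closure_subset[of \<Omega>] by blast
  have g: "g \<in> L2 (surface_measure \<Omega>)" using data(2) by (simp add: H_half_def)
  have in_H1: "u \<in> H1 \<Omega>" if "u \<in> F" for u
    using that classes(1) by (intro C1_in_H1[OF domain(1,2)]) (auto dest: C1_PNN)
  have ubar_F: "ubar \<in> F" using ubar classes(3) by (auto simp: is_arg_min_def)
  note lower = ritz_loss_excess_lower[OF domain(1) data(1) g \<omega>_meas C trace solution(1)]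
  note upper = ritz_loss_excess_upper[OF domain(1) data(1) g \<omega>_meas C trace solution(1) in_H1[OF ubar_F]]
  have "\<forall>x\<in>\<Omega>. c0 \<le> \<omega> x" using coercive(2) closure_subset[of \<Omega>] by blast
  then have low: "min c0 1 / 2 * ?e (u_A \<xi>) \<le> ?L (u_A \<xi>) - ?L u0"
    by (rule lower[OF in_H1[OF outcome(2)]])
  \<comment> \<open>The data bound may be infinite. The product on the right is then infinite as
      well, unless \<open>ubar\<close> is at distance zero from \<open>u0\<close>; in that case
      \<open>\<infinity> * 0 = 0\<close>, and the excess is estimated through the finite bound
      \<open>C\<close> of the coefficient.\<close>
  have approx: "ereal (?L ubar - ?L u0) \<le> ?D / 2 * ereal (?e ubar)"
  proof (cases ?D)
    case (real b)
    have b1: "1 \<le> b"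
    proof -
      have "1 \<le> ?D" by simp
      then show ?thesis unfolding real by simp
    qed
    have "AE x in lebesgue_on \<Omega>. \<bar>\<omega> x\<bar> \<le> b"
      using essential_bound_le_data_bound[of \<omega> \<Omega> h g]
    proof eventually_elim
      case (elim x)
      then have "ereal \<bar>\<omega> x\<bar> \<le> ?D" by (rule max.coboundedI1)
      then show ?case unfolding real by simp
    qed
    from upper[OF this b1] show ?thesis unfolding real by simp
  next
    case PInf
    show ?thesis
    proof (cases "?e ubar = 0")
      case True
      have "AE x in lebesgue_on \<Omega>. \<bar>\<omega> x\<bar> \<le> max C 1"
        using C by (intro AE_I2) (auto intro: max.coboundedI1)
      from upper[OF this] True have "ereal (?L ubar - ?L u0) \<le> 0" by simp
      also have "0 = ?D / 2 * ereal (?e ubar)"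
        by (simp only: True zero_ereal_def[symmetric] ereal_mult_zero)
      finally show ?thesis .
    next
      case False
      then have "0 < ?e ubar" by (simp add: less_le)
      then show ?thesis unfolding PInf by simp
    qed
  next
    case MInf
    have "1 \<le> ?D" by simp
    then show ?thesis unfolding MInf by simp
  qed
  \<comment> \<open>Insert the empirical loss at the output and at the best approximation.\<close>
  have "ereal (?L (u_A \<xi>) - ?L u0) \<le> ereal (?L ubar - ?L u0) +
      ereal (Lhat \<xi> (u_A \<xi>) - Lhat \<xi> ubar) +
      ereal (\<bar>?L (u_A \<xi>) - Lhat \<xi> (u_A \<xi>)\<bar> + \<bar>?L ubar - Lhat \<xi> ubar\<bar>)"
    by simp
  also have "\<dots> \<le> ?D / 2 * ereal (?e ubar) + ereal (Lhat \<xi> (u_A \<xi>) - Lhat \<xi> ubar) + 2 * ?S"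
    by (intro add_mono approx order_refl ereal_le_double_SUP[of _ F _ "\<lambda>u. ?L u - Lhat \<xi> u"] outcome ubar_F)
  finally have excess: "ereal (?L (u_A \<xi>) - ?L u0) \<le>
      ?D / 2 * ereal (?e ubar) + ereal (Lhat \<xi> (u_A \<xi>) - Lhat \<xi> ubar) + 2 * ?S" .
  have pos: "0 < min c0 1" using coercive(1) by simp
  have "?e (u_A \<xi>) \<le> 2 / min c0 1 * (?L (u_A \<xi>) - ?L u0)"
    using low pos by (simp add: field_simps)
  then have "ereal (?e (u_A \<xi>)) \<le> ereal (2 / min c0 1) * ereal (?L (u_A \<xi>) - ?L u0)" by simp
  also have "\<dots> \<le> ereal (2 / min c0 1) *
      (?D / 2 * ereal (?e ubar) + ereal (Lhat \<xi> (u_A \<xi>) - Lhat \<xi> ubar) + 2 * ?S)"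
    using excess pos by (intro ereal_mult_left_mono) auto
  finally show ?thesis .
qed

end
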